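(* For every integer $r\geq 4$ we have $g(n,r)=r^{n/2+o(n)}$ as $n\to\infty$. Moreover, for every $\varepsilon>0$ there exist $\delta,n_0>0$ such that for all integers $n\geq n_0$ the following holds. If $A\subseteq[n]$ satisfies $g(A,r)\geq r^{n/2-\delta n}$, then (i) if $r\geq 5$, either $|A\triangle O|\leq \varepsilon n$ or $|A\triangle I_0|\leq\varepsilon n$; (ii) if $r=4$, either $|A\triangle[n]|\leq\varepsilon n$, or $|A\triangle O|\leq\varepsilon n$, or $|A\triangle I_0|\leq\varepsilon n$.
   Context: $[n]=\{1,\dots,n\}$; $O=\{1,3,5,\dots,2\lceil n/2\rceil-1\}$ is the set of odd numbers in $[n]$, and $I_0=[\lfloor n/2\rfloor+1,n]=\{\lfloor n/2\rfloor+1,\dots,n\}$. An $r$-coloring of $A$ is a map $A\to[r]$. A rainbow sum is a triple of three distinct elements $x,y,z$ with $x+y=z$ colored with three different colors; a coloring is rainbow sum-free if it has no rainbow sum. $g(A,r)$ is the number of rainbow sum-free $r$-colorings of $A$, and $g(n,r)=\max_{A\subseteq[n]}g(A,r)$. $\triangle$ denotes symmetric difference. *)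

theory Defs
  imports Complex_Main "HOL-Library.FuncSet" "HOL-Library.Landau_Symbols"
begin

definition rainbow_sum :: "nat set \<Rightarrow> (nat \<Rightarrow> nat) \<Rightarrow> nat \<Rightarrow> nat \<Rightarrow> nat \<Rightarrow> bool" where
  "rainbow_sum A c x y z \<longleftrightarrow>
     x \<in> A \<and> y \<in> A \<and> z \<in> A \<and> x \<noteq> y \<and> x \<noteq> z \<and> y \<noteq> z \<and> x + y = z \<and>
     c x \<noteq> c y \<and> c x \<noteq> c z \<and> c y \<noteq> c z"

definition rainbow_sum_free :: "nat set \<Rightarrow> (nat \<Rightarrow> nat) \<Rightarrow> bool" where
  "rainbow_sum_free A c \<longleftrightarrow> \<not> (\<exists>x y z. rainbow_sum A c x y z)"

text \<open>Colorings are extensional functions, so that each map from \<open>A\<close> to \<open>{1..r}\<close> is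
  counted exactly once.\<close>

definition g_set :: "nat set \<Rightarrow> nat \<Rightarrow> nat" where
  "g_set A r = card {c \<in> A \<rightarrow>\<^sub>E {1..r}. rainbow_sum_free A c}"

definition g_max :: "nat \<Rightarrow> nat \<Rightarrow> nat" where
  "g_max n r = Max ((\<lambda>A. g_set A r) ` Pow {1..n})"

definition odd_part :: "nat \<Rightarrow> nat set" where
  "odd_part n = {k \<in> {1..n}. odd k}"

definition upper_half :: "nat \<Rightarrow> nat set" where
  "upper_half n = {n div 2 + 1..n}"

end

theory Submission
  imports Defs
begin

text \<open>
  A coloring is an independent set of the 3-uniform hypergraph on \<open>[n] \<times> [r]\<close> whose edges are the
  rainbow sums. As any two vertices have bounded codegree, the independent sets are covered by
  \<open>exp (o(n))\<close> containers with \<open>o(n\<^sup>2)\<close> edges each, so it suffices to bound the number of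
  colorings inside one assignment of palettes. With \<open>B \<subseteq> C\<close> the elements whose palettes have at least
  3 and at least 2 colors, that number is at most \<open>r\<^bsup>|B|\<^esup> 2\<^bsup>|C| - |B|\<^esup>\<close>, and a sum
  with one member in \<open>B\<close>, a second one in \<open>C\<close> and the third in \<open>A\<close> always spans a rainbow sum.

  For a nearly maximal typical \<open>b \<in> B\<close> at most about half of \<open>[1, b]\<close> lies in \<open>C\<close>, hence
  \<open>|B| + |C| \<le> n + o(n)\<close> unless \<open>B\<close> is negligible; as \<open>2 \<le> r\<^bsup>1/2\<^esup>\<close>, the upper bound follows.
  In case of near-equality \<open>B\<close> has density 1/2 and few sums. Let \<open>a\<close> be its least typical element.
  If \<open>a\<close> is not small, reflection at \<open>b\<close> and shifts by elements of \<open>B\<close> force \<open>a\<close> to be near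
  \<open>n/2\<close>. If \<open>a\<close> is small, shifts by elements of \<open>B\<close> nearly complement \<open>B\<close>; the shifts that nearly
  preserve or nearly complement \<open>B\<close> include all short ones, and so the sign of the shift by \<open>t\<close>
  is multiplicative in \<open>t\<close>, which leaves only the parity.
\<close>

section \<open>Containers for triple systems with bounded codegrees\<close>

text \<open>Branching on a vertex of out-degree at least \<open>d\<close> yields the recursion
  \<open>f(m) \<le> f(m - 1) + f(m - d)\<close> for the number of containers; this is the condition on \<open>\<beta>\<close>.\<close>

lemma digraph_containers:
  fixes G :: "'a \<Rightarrow> 'a \<Rightarrow> bool" and \<beta> :: real
  assumes "finite C" and \<beta>: "\<beta> \<ge> 1" "1 / \<beta> + 1 / \<beta> ^ d \<le> 1"
  shows "\<exists>\<F>. finite \<F> \<and> real (card \<F>) \<le> \<beta> ^ card C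
    \<and> (\<forall>F\<in>\<F>. F \<subseteq> C \<and> (\<forall>v\<in>F. card {w\<in>F. G v w} < d))
    \<and> (\<forall>I\<subseteq>C. (\<forall>v\<in>I. \<forall>w\<in>I. \<not> G v w) \<longrightarrow> (\<exists>F\<in>\<F>. I \<subseteq> F))"
  using assms(1)
proof (induction C rule: finite_psubset_induct)
  case (psubset C)
  have finC: "finite C" by (rule psubset(1))
  have d: "d \<ge> 1"
  proof (rule ccontr)
    assume "\<not> d \<ge> 1"
    then have "d = 0" by simp
    with \<beta> have "1 / \<beta> \<le> 0" by simp
    with \<beta>(1) show False by (simp add: divide_le_0_iff)
  qed
  show ?case
  proof (cases "\<forall>v\<in>C. card {w\<in>C. G v w} < d")
    case True
    show ?thesis
      by (rule exI[of _ "{C}"]) (use True \<beta> in auto)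
  next
    case False
    then obtain v where v: "v \<in> C" "card {w\<in>C. G v w} \<ge> d" by force
    define C1 where "C1 = C - {v}"
    define C2 where "C2 = C - {w\<in>C. G v w}"
    have ne: "{w\<in>C. G v w} \<noteq> {}" using v(2) d by (intro notI) simp
    have c1: "card C1 = card C - 1" "C1 \<subset> C"
      using v(1) finC by (auto simp: C1_def)
    have c2: "card C2 \<le> card C - d" "C2 \<subset> C"
    proof -
      have "card C2 = card C - card {w\<in>C. G v w}"
        unfolding C2_def using finC by (intro card_Diff_subset) auto
      with v(2) show "card C2 \<le> card C - d" by simp
      show "C2 \<subset> C" unfolding C2_def using ne by blast
    qed
    have dC: "d \<le> card C" using v(2) finC card_mono[of C "{w\<in>C. G v w}"] by auto
    obtain F1 where F1: "finite F1" "real (card F1) \<le> \<beta> ^ card C1"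
      "\<forall>F\<in>F1. F \<subseteq> C1 \<and> (\<forall>v\<in>F. card {w\<in>F. G v w} < d)"
      "\<forall>I\<subseteq>C1. (\<forall>v\<in>I. \<forall>w\<in>I. \<not> G v w) \<longrightarrow> (\<exists>F\<in>F1. I \<subseteq> F)"
      using psubset.IH[OF c1(2)] by (elim exE conjE) (rule that)
    obtain F2 where F2: "finite F2" "real (card F2) \<le> \<beta> ^ card C2"
      "\<forall>F\<in>F2. F \<subseteq> C2 \<and> (\<forall>v\<in>F. card {w\<in>F. G v w} < d)"
      "\<forall>I\<subseteq>C2. (\<forall>v\<in>I. \<forall>w\<in>I. \<not> G v w) \<longrightarrow> (\<exists>F\<in>F2. I \<subseteq> F)"
      using psubset.IH[OF c2(2)] by (elim exE conjE) (rule that)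
    have "real (card (F1 \<union> F2)) \<le> real (card F1) + real (card F2)"
      using card_Un_le[of F1 F2] by linarith
    also have "\<dots> \<le> \<beta> ^ (card C - 1) + \<beta> ^ (card C - d)"
      using F1(2) F2(2) c1(1) power_increasing[OF c2(1) \<beta>(1)] by (simp; linarith)
    also have "\<dots> = \<beta> ^ card C * (1 / \<beta> + 1 / \<beta> ^ d)"
      using \<beta>(1) dC d by (simp add: power_diff field_simps)
    also have "\<dots> \<le> \<beta> ^ card C"
      using \<beta> by (intro mult_left_le) auto
    finally have card: "real (card (F1 \<union> F2)) \<le> \<beta> ^ card C" .
    have cov: "\<exists>F\<in>F1 \<union> F2. I \<subseteq> F"
      if I: "I \<subseteq> C" "\<forall>v\<in>I. \<forall>w\<in>I. \<not> G v w" for I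
    proof (cases "v \<in> I")
      case True
      then have "I \<subseteq> C2" using I by (auto simp: C2_def)
      with F2(4) I(2) have "\<exists>F\<in>F2. I \<subseteq> F" by simp
      then show ?thesis by blast
    next
      case False
      then have "I \<subseteq> C1" using I by (auto simp: C1_def)
      with F1(4) I(2) have "\<exists>F\<in>F1. I \<subseteq> F" by simp
      then show ?thesis by blast
    qed
    have "\<forall>F\<in>F1 \<union> F2. F \<subseteq> C \<and> (\<forall>v\<in>F. card {w\<in>F. G v w} < d)"
    proof
      fix F assume "F \<in> F1 \<union> F2"
      then have "(F \<subseteq> C1 \<or> F \<subseteq> C2) \<and> (\<forall>v\<in>F. card {w\<in>F. G v w} < d)"
        using F1(3) F2(3) by blast
      with c1(2) c2(2) show "F \<subseteq> C \<and> (\<forall>v\<in>F. card {w\<in>F. G v w} < d)" by blast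
    qed
    then show ?thesis
      using F1(1) F2(1) card cov by (intro exI[of _ "F1 \<union> F2"]) simp
  qed
qed

text \<open>Counts the possible fingerprints \<open>Q\<close> of a container round. For fixed
  \<open>K\<close> the bound is polynomial in the size of the ground set, hence negligible against
  an exponential budget.\<close>

lemma card_bounded_subsets_le:
  assumes "finite C"
  shows "card {Q. Q \<subseteq> C \<and> card Q \<le> K} \<le> (card C + 1) ^ K"
proof (induction K)
  case 0
  have "{Q. Q \<subseteq> C \<and> card Q \<le> 0} \<subseteq> {{}}"
    using assms finite_subset by (auto simp: card_eq_0_iff)
  from card_mono[OF _ this] show ?case by simp
next
  case (Suc K)
  let ?S = "{Q. Q \<subseteq> C \<and> card Q \<le> K}"
  have fin: "finite ?S" using assms by simp
  have "{Q. Q \<subseteq> C \<and> card Q \<le> Suc K} \<subseteq> ?S \<union> (\<lambda>(x, Q). insert x Q) ` (C \<times> ?S)"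
  proof
    fix Q assume Q: "Q \<in> {Q. Q \<subseteq> C \<and> card Q \<le> Suc K}"
    show "Q \<in> ?S \<union> (\<lambda>(x, Q). insert x Q) ` (C \<times> ?S)"
    proof (cases "card Q \<le> K")
      case False
      then obtain x where x: "x \<in> Q" by fastforce
      have "card (Q - {x}) \<le> K" using Q x False by (auto simp: card_Diff_subset)
      then have "(x, Q - {x}) \<in> C \<times> ?S" using Q x by auto
      then have "insert x (Q - {x}) \<in> (\<lambda>(x, Q). insert x Q) ` (C \<times> ?S)"
        by (rule rev_image_eqI) simp
      then show ?thesis using x by (simp add: insert_absorb)
    qed (use Q in simp)
  qed
  then have "card {Q. Q \<subseteq> C \<and> card Q \<le> Suc K}
      \<le> card (?S \<union> (\<lambda>(x, Q). insert x Q) ` (C \<times> ?S))"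
    using fin assms by (intro card_mono) auto
  also have "\<dots> \<le> card ?S + card (C \<times> ?S)"
    using card_Un_le card_image_le[of "C \<times> ?S"] fin assms
    by (metis (no_types, lifting) add_left_mono finite_SigmaI le_trans)
  also have "\<dots> = (card C + 1) * card ?S" by (simp add: card_cartesian_product)
  also have "\<dots> \<le> (card C + 1) ^ Suc K"
    unfolding power_Suc by (rule mult_le_mono2[OF Suc.IH])
  finally show ?case .
qed

section \<open>Containers for systems of ordered triples\<close>

definition triples_in :: "('a \<Rightarrow> 'a \<Rightarrow> 'a \<Rightarrow> bool) \<Rightarrow> 'a set \<Rightarrow> ('a \<times> 'a \<times> 'a) set" where
  "triples_in T F = {(u, v, w). u \<in> F \<and> v \<in> F \<and> w \<in> F \<and> T u v w}"

text \<open>\<open>T\<close> relates ordered triples, so each of the three positions of the free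
  vertex gets its own bound.\<close>

definition codegrees_le :: "'a set \<Rightarrow> ('a \<Rightarrow> 'a \<Rightarrow> 'a \<Rightarrow> bool) \<Rightarrow> nat \<Rightarrow> bool" where
  "codegrees_le V T c \<longleftrightarrow> (\<forall>x\<in>V. \<forall>y\<in>V. card {z\<in>V. T x y z} \<le> c
     \<and> card {z\<in>V. T x z y} \<le> c \<and> card {z\<in>V. T z x y} \<le> c)"

lemma finite_triples_in: "finite F \<Longrightarrow> finite (triples_in T F)"
  by (rule finite_subset[of _ "F \<times> F \<times> F"]) (auto simp: triples_in_def)

lemma card_pairs_le:
  assumes "finite X" "\<And>x. x \<in> X \<Longrightarrow> finite (R x)" "\<And>x. x \<in> X \<Longrightarrow> card (R x) \<le> k"
  shows "card (Sigma X R) \<le> card X * k"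
  using assms by (simp add: card_SigmaI) (metis mult.commute sum_bounded_above of_nat_id)

text \<open>An independent set either contains few vertices of large degree, and then we list these and
  discard the others, or it contains \<open>K\<close> of them, and then it is independent in the union of their
  links, whose average and maximum degrees are both of order \<open>K\<close>.\<close>

lemma container_round:
  fixes T :: "'a \<Rightarrow> 'a \<Rightarrow> 'a \<Rightarrow> bool" and \<beta> \<kappa> :: real
  assumes V: "finite V" "C \<subseteq> V" and codeg: "codegrees_le V T c" and c: "c \<ge> 1"
    and \<kappa>: "\<kappa> > 0" and many: "real (card (triples_in T C)) \<ge> \<kappa> * real (card V) ^ 2"
    and \<beta>: "\<beta> \<ge> 1" "1 / \<beta> + 1 / \<beta> ^ d \<le> 1"
    and K: "4 * real c * real d \<le> real K * \<kappa>" "4 * real c * real K \<le> \<kappa> * real (card V)" "K \<ge> 1"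
  shows "\<exists>\<F>. finite \<F> \<and> real (card \<F>) \<le> real (card V + 1) ^ K * \<beta> ^ card V
    \<and> (\<forall>F\<in>\<F>. F \<subseteq> C \<and> real (card F) \<le> real (card C) - \<kappa> / (8 * real c ^ 2) * real (card V))
    \<and> (\<forall>I\<subseteq>C. triples_in T I = {} \<longrightarrow> (\<exists>F\<in>\<F>. I \<subseteq> F))"
proof -
  define N where "N = real (card V)"
  have fC: "finite C" using V finite_subset by blast
  have cg: "card {z\<in>V. T x y z} \<le> c" "card {z\<in>V. T x z y} \<le> c" "card {z\<in>V. T z x y} \<le> c"
    if "x \<in> V" "y \<in> V" for x y
    using codeg that by (auto simp: codegrees_le_def)
  have CN: "real (card C) \<le> N" using V by (simp add: N_def card_mono)
  define L where "L u = {(v, w). v \<in> C \<and> w \<in> C \<and> T u v w}" for u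
  have LS: "L u = Sigma C (\<lambda>v. {w\<in>C. T u v w})" for u by (auto simp: L_def)
  have fL: "finite (L u)" for u unfolding LS using fC by auto
  have sub: "card {z\<in>F. P z} \<le> card {z\<in>V. P z}" if "F \<subseteq> V" for F P
    using that V by (intro card_mono) auto
  have Lle: "real (card (L u)) \<le> N * c" if "u \<in> C" for u
  proof -
    have "card (L u) \<le> card C * c" unfolding LS
      using fC that V(2) by (intro card_pairs_le order.trans[OF sub[OF V(2)] cg(1)]) auto
    then have "real (card (L u)) \<le> real (card C) * c" by (metis of_nat_le_iff of_nat_mult)
    also have "\<dots> \<le> N * c" using CN by (simp add: mult_right_mono)
    finally show ?thesis .
  qed
  \<comment> \<open>The threshold is half of the average link size. Links have at most
    \<open>N * c\<close> pairs and the vertices outside \<open>W\<close> account for at most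
    \<open>\<kappa> * N ^ 2 / 2\<close> triples, which leaves at least
    \<open>\<kappa> * N / (2 * c)\<close> vertices in \<open>W\<close>.\<close>
  define W where "W = {u\<in>C. real (card (L u)) \<ge> \<kappa> * N / 2}"
  have fW: "finite W" "W \<subseteq> C" using fC by (auto simp: W_def)
  have cardW: "real (card W) \<ge> \<kappa> * N / (2 * c)"
  proof -
    have "triples_in T C = Sigma C L" by (auto simp: triples_in_def L_def)
    then have "\<kappa> * N ^ 2 \<le> (\<Sum>u\<in>C. real (card (L u)))"
      using many fC fL by (simp add: card_SigmaI N_def)
    also have "\<dots> = (\<Sum>u\<in>W. real (card (L u))) + (\<Sum>u\<in>C - W. real (card (L u)))"
      using fW fC by (metis add.commute sum.subset_diff)
    also have "(\<Sum>u\<in>W. real (card (L u))) \<le> card W * (N * c)"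
      using Lle fW by (intro sum_bounded_above) auto
    also have "(\<Sum>u\<in>C - W. real (card (L u))) \<le> card (C - W) * (\<kappa> * N / 2)"
      by (intro sum_bounded_above) (auto simp: W_def)
    also have "\<dots> \<le> N * (\<kappa> * N / 2)"
      using CN \<kappa> card_mono[OF fC, of "C - W"] by (intro mult_right_mono) (auto simp: N_def)
    finally have *: "\<kappa> * N ^ 2 / 2 \<le> card W * (N * c)" by (simp add: power2_eq_square algebra_simps)
    have "N > 0"
    proof (rule ccontr)
      assume "\<not> N > 0"
      then have "N = 0" by (simp add: N_def)
      with K(2) have "4 * real c * real K \<le> 0" by (simp add: N_def)
      moreover have "4 * real c * real K > 0" using c K(3) by simp
      ultimately show False by simp
    qed
    then show ?thesis using * c by (simp add: field_simps power2_eq_square)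
  qed
  define E where "E Q v w \<longleftrightarrow> (\<exists>u\<in>Q. T u v w)" for Q v w
  \<comment> \<open>\<open>good Q \<F>\<close> asks \<open>\<F>\<close> to cover the independent
    sets with fingerprint \<open>Q\<close>: the whole trace on \<open>W\<close> if it has fewer than
    \<open>K\<close> elements, otherwise any \<open>K\<close> elements of the trace.\<close>
  define good where "good Q = (\<lambda>\<F>. finite \<F> \<and> real (card \<F>) \<le> \<beta> ^ card C
    \<and> (\<forall>F\<in>\<F>. F \<subseteq> C \<and> real (card F) \<le> real (card C) - \<kappa> / (8 * real c ^ 2) * N)
    \<and> (\<forall>I\<subseteq>C. triples_in T I = {} \<and> (if card Q < K then I \<inter> W = Q else Q \<subseteq> I) \<longrightarrow> (\<exists>F\<in>\<F>. I \<subseteq> F)))" for Q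
  have N0: "N \<ge> 0" by (simp add: N_def)
  have ex: "\<exists>\<F>. good Q \<F>" if Q: "Q \<subseteq> W" "card Q \<le> K" for Q
  proof (cases "card Q < K")
    case True
    \<comment> \<open>All of \<open>W\<close> except \<open>Q\<close> is discarded. As
      \<open>K\<close> is at most half of the lower bound for \<open>card W\<close>, at least
      \<open>\<kappa> * N / (4 * c)\<close> vertices are lost.\<close>
    have "real (card (C - W \<union> Q)) \<le> real (card (C - W)) + card Q"
      using card_Un_le[of "C - W" Q] by linarith
    also have "real (card (C - W)) = card C - real (card W)"
      using fW fC by (simp add: card_Diff_subset card_mono of_nat_diff)
    also have "real (card Q) \<le> K" using Q by simp
    also have "real K \<le> \<kappa> * N / (4 * c)" using K c by (simp add: N_def field_simps)
    finally have "real (card (C - W \<union> Q)) \<le> card C - \<kappa> * N / (4 * c)"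
      using cardW by simp
    moreover have "\<kappa> * N / (4 * c) \<ge> \<kappa> * N / (8 * c ^ 2)"
    proof -
      have "real c * 1 \<le> real c * real c" using c by (intro mult_left_mono) auto
      then show ?thesis using c \<kappa> N0
        by (intro divide_left_mono) (auto simp: power2_eq_square)
    qed
    ultimately have "real (card (C - W \<union> Q)) \<le> card C - \<kappa> / (8 * real c ^ 2) * N" by simp
    moreover have "C - W \<union> Q \<subseteq> C" using Q fW by auto
    moreover have "\<forall>I\<subseteq>C. triples_in T I = {} \<and> I \<inter> W = Q \<longrightarrow> I \<subseteq> C - W \<union> Q" by auto
    moreover have "1 \<le> \<beta> ^ card C" using \<beta> by (simp add: one_le_power)
    ultimately have "good Q {C - W \<union> Q}"
      unfolding good_def using True by simp
    then show ?thesis by blast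
  next
    case False
    then have cQ: "card Q = K" using Q by simp
    have fQ: "finite Q" using Q fW finite_subset by blast
    obtain \<F> where \<F>: "finite \<F>" "real (card \<F>) \<le> \<beta> ^ card C"
      "\<forall>F\<in>\<F>. F \<subseteq> C \<and> (\<forall>v\<in>F. card {w\<in>F. E Q v w} < d)"
      "\<forall>I\<subseteq>C. (\<forall>v\<in>I. \<forall>w\<in>I. \<not> E Q v w) \<longrightarrow> (\<exists>F\<in>\<F>. I \<subseteq> F)"
      using digraph_containers[OF fC \<beta>, of "E Q"] by (elim exE conjE) (rule that)
    define P where "P = {(v, w). v \<in> C \<and> w \<in> C \<and> E Q v w}"
    have fP: "finite P" by (rule finite_subset[of _ "C \<times> C"]) (use fC in \<open>auto simp: P_def\<close>)
    \<comment> \<open>Add up the links of the \<open>K\<close> vertices of \<open>Q\<close>; by the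
      codegree bound a pair lies in at most \<open>c\<close> of them.\<close>
    have Pge: "real (card P) * c \<ge> K * (\<kappa> * N / 2)"
    proof -
      have "K * (\<kappa> * N / 2) \<le> (\<Sum>u\<in>Q. real (card (L u)))"
        using Q cQ by (intro order.trans[OF _ sum_bounded_below[of Q "\<kappa> * N / 2"]]) (auto simp: W_def)
      also have "\<dots> = card (Sigma Q L)" using fQ fL by (simp add: card_SigmaI)
      also have "\<dots> = card ((\<lambda>(u, p). (p, u)) ` Sigma Q L)"
        by (subst card_image) (auto simp: inj_on_def)
      also have "\<dots> \<le> card (Sigma P (\<lambda>(v, w). {u\<in>V. T u v w}))"
        using Q fW V fP
        by (intro of_nat_mono card_mono finite_SigmaI) (auto simp: P_def L_def E_def)
      also have "card (Sigma P (\<lambda>(v, w). {u\<in>V. T u v w})) \<le> card P * c"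
        using fP V by (intro card_pairs_le) (auto simp: P_def intro!: cg)
      finally show ?thesis by simp
    qed
    \<comment> \<open>At most \<open>card F * d\<close> pairs lie inside \<open>F\<close>, and by
      the first condition on \<open>K\<close> these account for at most half of the lower bound
      \<open>Pge\<close>. All other pairs meet \<open>D\<close>, the part of \<open>C\<close>
      outside \<open>F\<close>, where in- and out-degrees are at most \<open>K * c\<close>; so
      \<open>D\<close> is large.\<close>
    have size: "real (card F) \<le> real (card C) - \<kappa> / (8 * real c ^ 2) * N" if F: "F \<in> \<F>" for F
    proof -
      have FC: "F \<subseteq> C" and deg: "\<And>v. v \<in> F \<Longrightarrow> card {w\<in>F. E Q v w} < d"
        using \<F>(3) F by auto
      have fF: "finite F" using FC fC finite_subset by blast
      define D where "D = C - F"
      have fD: "finite D" using fC by (simp add: D_def)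
      have bd: "card {w\<in>C. E Q v w} \<le> K * c" "card {w\<in>C. E Q w v} \<le> K * c" if v: "v \<in> C" for v
      proof -
        have vV: "v \<in> V" and QV: "\<And>u. u \<in> Q \<Longrightarrow> u \<in> V" using v V Q fW by auto
        have "{w\<in>C. E Q v w} \<subseteq> (\<lambda>p. snd p) ` Sigma Q (\<lambda>u. {w\<in>V. T u v w})"
          using V by (force simp: E_def)
        then have "card {w\<in>C. E Q v w} \<le> card (Sigma Q (\<lambda>u. {w\<in>V. T u v w}))"
          using fQ V by (intro surj_card_le) auto
        also have "\<dots> \<le> card Q * c"
          using fQ QV V(1) vV by (intro card_pairs_le cg) auto
        finally show "card {w\<in>C. E Q v w} \<le> K * c" using cQ by simp
        have "{w\<in>C. E Q w v} \<subseteq> (\<lambda>p. snd p) ` Sigma Q (\<lambda>u. {w\<in>V. T u w v})"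
          using V by (force simp: E_def)
        then have "card {w\<in>C. E Q w v} \<le> card (Sigma Q (\<lambda>u. {w\<in>V. T u w v}))"
          using fQ V by (intro surj_card_le) auto
        also have "\<dots> \<le> card Q * c"
          using fQ QV V(1) vV by (intro card_pairs_le cg) auto
        finally show "card {w\<in>C. E Q w v} \<le> K * c" using cQ by simp
      qed
      let ?A = "Sigma F (\<lambda>v. {w\<in>F. E Q v w})"
      let ?B = "Sigma D (\<lambda>v. {w\<in>C. E Q v w})"
      let ?B' = "Sigma D (\<lambda>v. {w\<in>C. E Q w v})"
      have "P \<subseteq> ?A \<union> ?B \<union> prod.swap ` ?B'"
        by (auto simp: P_def D_def image_iff)
      then have "card P \<le> card (?A \<union> ?B \<union> prod.swap ` ?B')"
        using fF fD fC by (intro card_mono) auto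
      also have "\<dots> \<le> card ?A + card ?B + card (prod.swap ` ?B')"
        using card_Un_le[of "?A \<union> ?B" "prod.swap ` ?B'"] card_Un_le[of ?A ?B] by linarith
      also have "card (prod.swap ` ?B') \<le> card ?B'"
        using fD fC by (intro card_image_le) auto
      also have "card ?A \<le> card F * d"
        using deg fF by (intro card_pairs_le) (auto intro: less_imp_le)
      also have "card ?B \<le> card D * (K * c)"
        using bd fD fC by (intro card_pairs_le) (auto simp: D_def)
      also have "card ?B' \<le> card D * (K * c)"
        using bd fD fC by (intro card_pairs_le) (auto simp: D_def)
      finally have "card P \<le> card F * d + 2 * (card D * (K * c))" by simp
      then have 1: "real (card P) \<le> card F * d + 2 * (card D * (K * c))"
        by (metis (mono_tags, lifting) of_nat_add of_nat_le_iff of_nat_mult of_nat_numeral)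
      have "real (card F) \<le> N" using CN card_mono[OF fC FC] by linarith
      then have "real (card F) * d * c \<le> N * (d * c)"
        by (simp add: mult.assoc mult_right_mono)
      also have "\<dots> \<le> N * (K * \<kappa> / 4)"
        using K(1) N0 by (intro mult_left_mono) (auto simp: field_simps)
      finally have 2: "real (card F) * d * c \<le> N * (K * \<kappa> / 4)" .
      have "K * (\<kappa> * N / 2) \<le> (card F * d + 2 * (card D * (K * c))) * real c"
        using Pge mult_right_mono[OF 1, of "real c"] by simp
      also have "\<dots> \<le> N * (K * \<kappa> / 4) + 2 * (card D * (K * c)) * real c"
        using 2 by (simp add: algebra_simps)
      finally have "real K * (\<kappa> * N / 4) \<le> real K * (2 * card D * real c ^ 2)"
        by (simp add: algebra_simps power2_eq_square)
      then have "\<kappa> * N / 4 \<le> 2 * card D * real c ^ 2" using K(3) by simp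
      then have "\<kappa> / (8 * real c ^ 2) * N \<le> card D" using c by (simp add: field_simps)
      moreover have "real (card D) = real (card C) - card F"
        using FC fF fC by (simp add: D_def card_Diff_subset card_mono of_nat_diff)
      ultimately show ?thesis by simp
    qed
    have "\<exists>F\<in>\<F>. I \<subseteq> F" if I: "I \<subseteq> C" "triples_in T I = {}" "Q \<subseteq> I" for I
    proof -
      have "\<not> E Q v w" if "v \<in> I" "w \<in> I" for v w
      proof
        assume "E Q v w"
        then obtain u where "u \<in> Q" "T u v w" by (auto simp: E_def)
        then have "(u, v, w) \<in> triples_in T I" using I(3) that by (auto simp: triples_in_def)
        with I(2) show False by simp
      qed
      then show ?thesis by (intro \<F>(4)[rule_format, OF I(1)])
    qed
    then have "\<forall>I\<subseteq>C. triples_in T I = {} \<and> Q \<subseteq> I \<longrightarrow> (\<exists>F\<in>\<F>. I \<subseteq> F)" by simp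
    moreover have "\<forall>F\<in>\<F>. F \<subseteq> C \<and> real (card F) \<le> real (card C) - \<kappa> / (8 * real c ^ 2) * N"
      using \<F>(3) size by blast
    ultimately have "good Q \<F>"
      unfolding good_def if_not_P[OF False] using \<F>(1,2) by (intro conjI)
    then show ?thesis by blast
  qed
  define \<Q> where "\<Q> = {Q. Q \<subseteq> W \<and> card Q \<le> K}"
  define f where "f Q = (SOME \<F>. good Q \<F>)" for Q
  have f: "good Q (f Q)" if "Q \<in> \<Q>" for Q
    unfolding f_def by (rule someI_ex) (use ex that in \<open>simp add: \<Q>_def\<close>)
  have f\<Q>: "finite \<Q>" using fW by (simp add: \<Q>_def)
  have c\<Q>: "card \<Q> \<le> (card V + 1) ^ K"
  proof -
    have "card W \<le> card V" using fW V by (intro card_mono) auto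
    then have "(card W + 1) ^ K \<le> (card V + 1) ^ K" by (intro power_mono) auto
    with card_bounded_subsets_le[OF fW(1), of K] show ?thesis by (simp add: \<Q>_def)
  qed
  have f_fin: "finite (f Q)" and f_card: "real (card (f Q)) \<le> \<beta> ^ card C"
    and f_size: "\<forall>F\<in>f Q. F \<subseteq> C \<and> real (card F) \<le> real (card C) - \<kappa> / (8 * real c ^ 2) * N"
    if "Q \<in> \<Q>" for Q
    using f[OF that, unfolded good_def] by - (elim conjE, assumption)+
  define \<F> where "\<F> = (\<Union>Q\<in>\<Q>. f Q)"
  have bC: "\<beta> ^ card C \<le> \<beta> ^ card V"
    using \<beta> V by (intro power_increasing card_mono) auto
  have "real (card \<F>) \<le> (\<Sum>Q\<in>\<Q>. real (card (f Q)))"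
    unfolding \<F>_def using card_UN_le[OF f\<Q>, of f] by (metis of_nat_le_iff of_nat_sum)
  also have "\<dots> \<le> card \<Q> * \<beta> ^ card C"
    using f_card by (intro sum_bounded_above) simp
  also have "\<dots> \<le> real (card V + 1) ^ K * \<beta> ^ card V"
  proof (rule mult_mono)
    show "real (card \<Q>) \<le> real (card V + 1) ^ K" using c\<Q> by (metis of_nat_le_iff of_nat_power)
  qed (use bC \<beta> in auto)
  finally have "real (card \<F>) \<le> real (card V + 1) ^ K * \<beta> ^ card V" .
  moreover have "finite \<F>" using f_fin f\<Q> by (auto simp: \<F>_def)
  moreover have "\<forall>F\<in>\<F>. F \<subseteq> C \<and> real (card F) \<le> real (card C) - \<kappa> / (8 * real c ^ 2) * N"
    using f_size by (simp add: \<F>_def)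
  moreover have "\<exists>F\<in>\<F>. I \<subseteq> F" if I: "I \<subseteq> C" "triples_in T I = {}" for I
  proof -
    obtain Q where Q: "Q \<in> \<Q>" "if card Q < K then I \<inter> W = Q else Q \<subseteq> I"
    proof (cases "card (I \<inter> W) < K")
      case True
      then show ?thesis using that[of "I \<inter> W"] by (simp add: \<Q>_def)
    next
      case False
      then obtain Q where "Q \<subseteq> I \<inter> W" "card Q = K" by (meson obtain_subset_with_card_n not_less)
      then show ?thesis using that[of Q] by (simp add: \<Q>_def)
    qed
    have "\<forall>I\<subseteq>C. triples_in T I = {} \<and> (if card Q < K then I \<inter> W = Q else Q \<subseteq> I)
        \<longrightarrow> (\<exists>F\<in>f Q. I \<subseteq> F)"
      using f[OF Q(1)] unfolding good_def by (elim conjE)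
    with I Q(2) have "\<exists>F\<in>f Q. I \<subseteq> F" by simp
    then show ?thesis using Q(1) by (auto simp: \<F>_def)
  qed
  then have "\<forall>I\<subseteq>C. triples_in T I = {} \<longrightarrow> (\<exists>F\<in>\<F>. I \<subseteq> F)" by simp
  ultimately show ?thesis unfolding N_def by (intro exI[of _ \<F>] conjI)
qed

text \<open>Every container that still spans \<open>\<kappa> * card V ^ 2\<close> triples is refined
  by another round. A round removes a fixed share of \<open>V\<close>, so \<open>R\<close> bounds
  the depth of the refinement, and the numbers of containers multiply.\<close>

lemma container_iterate:
  fixes T :: "'a \<Rightarrow> 'a \<Rightarrow> 'a \<Rightarrow> bool" and \<beta> \<kappa> :: real
  assumes V: "finite V" "C \<subseteq> V" and codeg: "codegrees_le V T c" and c: "c \<ge> 1"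
    and \<kappa>: "\<kappa> > 0"
    and \<beta>: "\<beta> \<ge> 1" "1 / \<beta> + 1 / \<beta> ^ d \<le> 1"
    and K: "4 * real c * real d \<le> real K * \<kappa>" "4 * real c * real K \<le> \<kappa> * real (card V)" "K \<ge> 1"
    and R: "real (card C) \<le> real R * (\<kappa> / (8 * real c ^ 2) * real (card V))"
  shows "\<exists>\<F>. finite \<F> \<and> real (card \<F>) \<le> (real (card V + 1) ^ K * \<beta> ^ card V) ^ R
    \<and> (\<forall>F\<in>\<F>. F \<subseteq> C \<and> real (card (triples_in T F)) < \<kappa> * real (card V) ^ 2)
    \<and> (\<forall>I\<subseteq>C. triples_in T I = {} \<longrightarrow> (\<exists>F\<in>\<F>. I \<subseteq> F))"
  using V(2) R
proof (induction R arbitrary: C)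
  case 0
  have "card V > 0"
  proof (rule gr0I)
    assume "card V = 0"
    with K(2) have "4 * real c * real K \<le> 0" by simp
    moreover have "4 * real c * real K > 0" using c K(3) by simp
    ultimately show False by simp
  qed
  have "C = {}" using 0 V finite_subset by (auto simp: card_eq_0_iff)
  moreover have "triples_in T {} = {}" by (auto simp: triples_in_def)
  ultimately show ?case using \<open>card V > 0\<close> \<kappa>
    by (intro exI[of _ "{{}}"]) auto
next
  case (Suc R)
  let ?X = "real (card V + 1) ^ K * \<beta> ^ card V"
  have X1: "?X \<ge> 1" using \<beta> mult_mono[of 1 "real (card V + 1) ^ K" 1 "\<beta> ^ card V"] by (simp add: one_le_power)
  show ?case
  proof (cases "real (card (triples_in T C)) < \<kappa> * real (card V) ^ 2")
    case True
    then show ?thesis using X1 one_le_power[OF X1, of "Suc R"] by (intro exI[of _ "{C}"]) auto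
  next
    case False
    then obtain \<G> where \<G>: "finite \<G>" "real (card \<G>) \<le> ?X"
      "\<And>F. F\<in>\<G> \<Longrightarrow> F \<subseteq> C \<and> real (card F) \<le> real (card C) - \<kappa> / (8 * real c ^ 2) * real (card V)"
      "\<And>I. I\<subseteq>C \<Longrightarrow> triples_in T I = {} \<Longrightarrow> (\<exists>F\<in>\<G>. I \<subseteq> F)"
      using container_round[OF V(1) Suc.prems(1) codeg c \<kappa> _ \<beta> K] by (auto simp: not_less)
    have "\<exists>\<F>. finite \<F> \<and> real (card \<F>) \<le> ?X ^ R
    \<and> (\<forall>F\<in>\<F>. F \<subseteq> D \<and> real (card (triples_in T F)) < \<kappa> * real (card V) ^ 2)
    \<and> (\<forall>I\<subseteq>D. triples_in T I = {} \<longrightarrow> (\<exists>F\<in>\<F>. I \<subseteq> F))" if "D \<in> \<G>" for D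
    proof (rule Suc.IH)
      show "D \<subseteq> V" using \<G>(3)[OF that] Suc.prems by auto
      have "real (Suc R) * s = s + real R * s" for s by (simp add: algebra_simps)
      from this[of "\<kappa> / (8 * real c ^ 2) * real (card V)"] \<G>(3)[OF that] Suc.prems(2)
      show "real (card D) \<le> real R * (\<kappa> / (8 * real c ^ 2) * real (card V))" by linarith
    qed
    then obtain f where f: "\<And>D. D \<in> \<G> \<Longrightarrow> finite (f D) \<and> real (card (f D)) \<le> ?X ^ R
    \<and> (\<forall>F\<in>f D. F \<subseteq> D \<and> real (card (triples_in T F)) < \<kappa> * real (card V) ^ 2)
    \<and> (\<forall>I\<subseteq>D. triples_in T I = {} \<longrightarrow> (\<exists>F\<in>f D. I \<subseteq> F))" by metis
    define \<F> where "\<F> = (\<Union>D\<in>\<G>. f D)"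
    have "real (card \<F>) \<le> (\<Sum>D\<in>\<G>. real (card (f D)))"
      unfolding \<F>_def using card_UN_le[OF \<G>(1), of f] by (metis of_nat_le_iff of_nat_sum)
    also have "\<dots> \<le> card \<G> * ?X ^ R" using f by (intro sum_bounded_above) simp
    also have "\<dots> \<le> ?X * ?X ^ R" using \<G>(2) X1 by (intro mult_right_mono) auto
    finally have "real (card \<F>) \<le> ?X ^ Suc R" by simp
    moreover have "finite \<F>" using \<G> f by (auto simp: \<F>_def)
    moreover have "\<forall>F\<in>\<F>. F \<subseteq> C \<and> real (card (triples_in T F)) < \<kappa> * real (card V) ^ 2"
    proof
      fix F assume "F \<in> \<F>"
      then obtain D where D: "D \<in> \<G>" "F \<in> f D" by (auto simp: \<F>_def)
      have "F \<subseteq> D" "real (card (triples_in T F)) < \<kappa> * real (card V) ^ 2"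
        using f[OF D(1)] D(2) by simp_all
      with \<G>(3)[OF D(1)] show "F \<subseteq> C \<and> real (card (triples_in T F)) < \<kappa> * real (card V) ^ 2"
        by auto
    qed
    moreover have "\<forall>I\<subseteq>C. triples_in T I = {} \<longrightarrow> (\<exists>F\<in>\<F>. I \<subseteq> F)"
    proof (intro allI impI)
      fix I assume I: "I \<subseteq> C" "triples_in T I = {}"
      obtain D where D: "D \<in> \<G>" "I \<subseteq> D" using \<G>(4)[OF I] by auto
      then obtain F where "F \<in> f D" "I \<subseteq> F" using f[OF D(1)] I(2) by auto
      with D show "\<exists>F\<in>\<F>. I \<subseteq> F" by (auto simp: \<F>_def)
    qed
    ultimately show ?thesis by (intro exI[of _ \<F>] conjI)
  qed
qed

theorem triple_containers:
  fixes \<kappa> \<gamma> :: real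
  assumes "\<kappa> > 0" "\<gamma> > 0" "c \<ge> 1"
  shows "\<exists>N\<^sub>0. \<forall>(V :: 'a set) T. finite V \<and> card V \<ge> N\<^sub>0 \<and> codegrees_le V T c \<longrightarrow>
    (\<exists>\<F>. finite \<F> \<and> real (card \<F>) \<le> exp (\<gamma> * real (card V))
    \<and> (\<forall>F\<in>\<F>. F \<subseteq> V \<and> real (card (triples_in T F)) < \<kappa> * real (card V) ^ 2)
    \<and> (\<forall>I\<subseteq>V. triples_in T I = {} \<longrightarrow> (\<exists>F\<in>\<F>. I \<subseteq> F)))"
proof -
  define R where "R = nat \<lceil>8 * real c ^ 2 / \<kappa>\<rceil>"
  have R: "real R \<ge> 8 * real c ^ 2 / \<kappa>" unfolding R_def by linarith
  have R0: "R \<ge> 1"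
  proof -
    have "8 * real c ^ 2 / \<kappa> > 0" using assms by simp
    with R have "real R > 0" by linarith
    then show ?thesis by simp
  qed
  \<comment> \<open>The \<open>R\<close> rounds together cost
    \<open>\<beta> ^ R = exp (\<gamma> / 2)\<close> per vertex; the other half of the exponent pays
    for the polynomial factor \<open>(card V + 1) ^ (K * R)\<close>. The constants are chosen in the
    order \<open>R\<close>, \<open>\<beta>\<close>, \<open>d\<close>, \<open>K\<close>.\<close>
  define \<beta> where "\<beta> = exp (\<gamma> / (2 * R))"
  have \<beta>: "\<beta> > 1" using assms R0 by (simp add: \<beta>_def)
  obtain d where d: "(1 / \<beta>) ^ d < 1 - 1 / \<beta>"
    using real_arch_pow_inv[of "1 - 1 / \<beta>" "1 / \<beta>"] \<beta> by auto
  have \<beta>d: "1 / \<beta> + 1 / \<beta> ^ d \<le> 1" using d by (simp add: power_one_over)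
  define K where "K = nat \<lceil>4 * real c * real d / \<kappa>\<rceil> + 1"
  have "real K \<ge> 4 * real c * real d / \<kappa>" unfolding K_def by linarith
  then have K: "4 * real c * real d \<le> real K * \<kappa>" "K \<ge> 1"
    using assms by (auto simp: K_def field_simps)
  \<comment> \<open>Insert \<open>x = \<gamma> / 2 * (N + 1)\<close> into
    \<open>x ^ (K * R) / exp x\<close>, which tends to 0. Comparison with the constant
    \<open>(\<gamma> / 2) ^ (K * R) / exp (\<gamma> / 2)\<close> removes both the factor
    \<open>\<gamma> / 2\<close> and the shift from \<open>N\<close> to \<open>N + 1\<close>.\<close>
  have "eventually (\<lambda>N::nat. real (N + 1) ^ (K * R) \<le> exp (\<gamma> / 2 * N)) sequentially"
  proof -
    have "((\<lambda>x. x ^ (K * R) / exp x) \<longlongrightarrow> 0) (at_top :: real filter)"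
      by (rule tendsto_power_div_exp_0)
    moreover have "filterlim (\<lambda>N::nat. \<gamma> / 2 * real (N + 1)) at_top sequentially"
    proof (rule filterlim_tendsto_pos_mult_at_top[OF tendsto_const])
      show "filterlim (\<lambda>N::nat. real (N + 1)) at_top sequentially"
        using filterlim_real_sequentially filterlim_sequentially_Suc[of real at_top] by simp
    qed (use assms in simp)
    ultimately have "((\<lambda>N::nat. (\<gamma> / 2 * real (N + 1)) ^ (K * R) / exp (\<gamma> / 2 * real (N + 1))) \<longlongrightarrow> 0) sequentially"
      by (rule filterlim_compose)
    then have "eventually (\<lambda>N::nat. (\<gamma> / 2 * real (N + 1)) ^ (K * R) / exp (\<gamma> / 2 * real (N + 1))
        < (\<gamma> / 2) ^ (K * R) / exp (\<gamma> / 2)) sequentially"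
      using assms by (intro order_tendstoD) auto
    then show ?thesis
    proof (rule eventually_mono)
      fix N :: nat
      assume "(\<gamma> / 2 * real (N + 1)) ^ (K * R) / exp (\<gamma> / 2 * real (N + 1))
        < (\<gamma> / 2) ^ (K * R) / exp (\<gamma> / 2)"
      then have "(\<gamma> / 2) ^ (K * R) * (real (N + 1) ^ (K * R) / exp (\<gamma> / 2 * real (N + 1)))
        < (\<gamma> / 2) ^ (K * R) * (1 / exp (\<gamma> / 2))"
        by (subst (asm) power_mult_distrib) simp
      then have "real (N + 1) ^ (K * R) / exp (\<gamma> / 2 * real (N + 1)) < 1 / exp (\<gamma> / 2)"
        using assms by (subst (asm) mult_less_cancel_left_pos) auto
      then have "real (N + 1) ^ (K * R) < exp (\<gamma> / 2 * real (N + 1)) / exp (\<gamma> / 2)"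
        by (simp add: field_simps)
      also have "\<dots> = exp (\<gamma> / 2 * N)" by (simp add: exp_diff[symmetric] algebra_simps)
      finally show "real (N + 1) ^ (K * R) \<le> exp (\<gamma> / 2 * N)" by simp
    qed
  qed
  then obtain N1 where N1: "\<And>N::nat. N \<ge> N1 \<Longrightarrow> real (N + 1) ^ (K * R) \<le> exp (\<gamma> / 2 * N)"
    by (auto simp: eventually_sequentially)
  define N0 where "N0 = max N1 (nat \<lceil>4 * real c * real K / \<kappa>\<rceil>)"
  show ?thesis
  proof (intro exI[of _ N0] allI impI, elim conjE)
    fix V :: "'a set" and T
    assume V: "finite V" "card V \<ge> N0" and codeg: "codegrees_le V T c"
    have "4 * real c * real K / \<kappa> \<le> card V" using V(2) unfolding N0_def by linarith
    then have K2: "4 * real c * real K \<le> \<kappa> * real (card V)" using assms by (simp add: field_simps)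
    have "1 \<le> real R * (\<kappa> / (8 * real c ^ 2))" using R assms by (simp add: field_simps)
    then have RV: "real (card V) \<le> real R * (\<kappa> / (8 * real c ^ 2) * real (card V))"
      using mult_right_mono[of 1 "real R * (\<kappa> / (8 * real c ^ 2))" "real (card V)"] by (simp add: mult.assoc)
    have "(real (card V + 1) ^ K * \<beta> ^ card V) ^ R = real (card V + 1) ^ (K * R) * (\<beta> ^ R) ^ card V"
      by (simp add: power_mult_distrib power_mult[symmetric] mult.commute)
    also have "\<beta> ^ R = exp (\<gamma> / 2)" using R0 by (simp add: \<beta>_def exp_of_nat_mult[symmetric])
    also have "exp (\<gamma> / 2) ^ card V = exp (\<gamma> / 2 * card V)"
      by (simp add: exp_of_nat_mult[symmetric] mult.commute)
    also have "real (card V + 1) ^ (K * R) * exp (\<gamma> / 2 * card V) \<le> exp (\<gamma> / 2 * card V) * exp (\<gamma> / 2 * card V)"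
      using N1[of "card V"] V(2) by (intro mult_right_mono) (auto simp: N0_def)
    also have "\<dots> = exp (\<gamma> * card V)" by (simp add: exp_add[symmetric])
    finally have le: "(real (card V + 1) ^ K * \<beta> ^ card V) ^ R \<le> exp (\<gamma> * card V)" .
    show "\<exists>\<F>. finite \<F> \<and> real (card \<F>) \<le> exp (\<gamma> * real (card V))
    \<and> (\<forall>F\<in>\<F>. F \<subseteq> V \<and> real (card (triples_in T F)) < \<kappa> * real (card V) ^ 2)
    \<and> (\<forall>I\<subseteq>V. triples_in T I = {} \<longrightarrow> (\<exists>F\<in>\<F>. I \<subseteq> F))"
    proof -
      obtain \<F> where \<F>: "finite \<F>" "real (card \<F>) \<le> (real (card V + 1) ^ K * \<beta> ^ card V) ^ R"
        "\<forall>F\<in>\<F>. F \<subseteq> V \<and> real (card (triples_in T F)) < \<kappa> * real (card V) ^ 2"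
        "\<forall>I\<subseteq>V. triples_in T I = {} \<longrightarrow> (\<exists>F\<in>\<F>. I \<subseteq> F)"
        using container_iterate[OF V(1) subset_refl codeg assms(3,1) less_imp_le[OF \<beta>] \<beta>d K(1) K2 K(2) RV]
        by (elim exE conjE) (rule that)
      from \<F>(2) le have "real (card \<F>) \<le> exp (\<gamma> * real (card V))" by (rule order.trans)
      with \<F> show ?thesis by (intro exI[of _ \<F>] conjI)
    qed
  qed
qed

section \<open>Sets with few sums\<close>

definition diff_pairs :: "nat set \<Rightarrow> nat \<Rightarrow> nat set" where
  "diff_pairs Y x = {y\<in>Y. x + y \<in> Y}"

definition sum_pairs :: "nat set \<Rightarrow> nat \<Rightarrow> nat set" where
  "sum_pairs Y x = {y\<in>Y. y < x \<and> x - y \<in> Y}"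

text \<open>\<open>X\<close> and \<open>Y\<close> are kept apart because elements of
  \<open>B\<close> are tested against \<open>C\<close>, and later those of \<open>A\<close> against
  \<open>B\<close>.\<close>

definition exceptional :: "nat set \<Rightarrow> nat set \<Rightarrow> nat \<Rightarrow> nat set" where
  "exceptional X Y e = {x\<in>X. card (diff_pairs Y x) > e \<or> card (sum_pairs Y x) > e}"

abbreviation fill :: "nat set \<Rightarrow> nat \<Rightarrow> nat \<Rightarrow> nat" where
  "fill Y p q \<equiv> card (Y \<inter> {p<..<q})"

abbreviation hole :: "nat set \<Rightarrow> nat \<Rightarrow> nat \<Rightarrow> nat" where
  "hole Y p q \<equiv> card ({p<..<q} - Y)"

definition missed_sums :: "nat set \<Rightarrow> nat \<Rightarrow> nat set" where
  "missed_sums Y b = {x\<in>{0<..<b}. x \<notin> Y \<and> b - x \<notin> Y}"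

lemma finite_diff_pairs: "finite Y \<Longrightarrow> finite (diff_pairs Y x)"
  and finite_sum_pairs: "finite Y \<Longrightarrow> finite (sum_pairs Y x)"
  and finite_missed_sums: "finite (missed_sums Y x)"
  by (auto simp: diff_pairs_def sum_pairs_def missed_sums_def)

section \<open>Counting under reflections and shifts\<close>

lemma fill_add_hole: "fill Y p q + hole Y p q = q - p - 1"
  using card_Int_Diff[of "{p<..<q}" Y] by (simp add: Int_commute)

lemma fill_mono: "p' \<le> p \<Longrightarrow> q \<le> q' \<Longrightarrow> fill Y p q \<le> fill Y p' q'"
  by (intro card_mono) auto

lemma hole_mono: "p' \<le> p \<Longrightarrow> q \<le> q' \<Longrightarrow> hole Y p q \<le> hole Y p' q'"
  by (intro card_mono) auto

lemma card_le_of_inj: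
  assumes "finite T" "inj_on f S" "f ` S \<subseteq> T"
  shows "card S \<le> card T"
  using card_inj_on_le assms by blast

lemma card_le_add:
  assumes "S \<subseteq> T \<union> U" "finite T" "finite U"
  shows "card S \<le> card T + card U"
  using card_mono[OF _ assms(1)] card_Un_le[of T U] assms(2,3) by simp

lemma card_complement_add:
  assumes "finite U" "S \<subseteq> U" "N = U - S"
  shows "card N + card S = card U"
  using assms card_Int_Diff[of U S] by (simp add: Int_absorb1 add.commute)

text \<open>Inclusion-exclusion for the part of \<open>Y\<close> in \<open>{0<..<b}\<close> and its
  mirror image under \<open>x \<mapsto> b - x\<close>. The intersection with \<open>{0<..<b}\<close>
  on the right drops \<open>y = 0\<close>, which \<open>sum_pairs\<close> admits.\<close>

lemma card_missed_sums:
  "card (missed_sums Y b) + 2 * fill Y 0 b = b - 1 + card (sum_pairs Y b \<inter> {0<..<b})"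
proof -
  let ?P = "Y \<inter> {0<..<b}" and ?R = "{x\<in>{0<..<b}. b - x \<in> Y}"
  have "bij_betw (\<lambda>x. b - x) ?P ?R"
    by (rule bij_betw_byWitness[where f' = "\<lambda>x. b - x"]) auto
  then have 1: "card ?R = card ?P" using bij_betw_same_card by fastforce
  have "?P \<inter> ?R = sum_pairs Y b \<inter> {0<..<b}" by (auto simp: sum_pairs_def)
  then have 2: "card (?P \<union> ?R) + card (sum_pairs Y b \<inter> {0<..<b}) = 2 * card ?P"
    using card_Un_Int[of ?P ?R] 1 by simp
  have "card (missed_sums Y b) + card (?P \<union> ?R) = card {0<..<b}"
    by (rule card_complement_add) (auto simp: missed_sums_def)
  with 2 show ?thesis by simp
qed

text \<open>A gap \<open>y\<close> of \<open>Y\<close> in the mirrored interval either comes from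
  \<open>b - y\<close> in \<open>Y\<close> or is a missed sum. So \<open>Y\<close> is dense on the
  mirror image of an interval on which it is sparse.\<close>

lemma hole_reflect_le:
  assumes "q \<le> b"
  shows "hole Y (b - q) (b - p) \<le> fill Y p q + card (missed_sums Y b)"
proof -
  let ?S = "{b - q<..<b - p} - Y"
  have "?S \<subseteq> (\<lambda>x. b - x) ` (Y \<inter> {p<..<q}) \<union> missed_sums Y b"
  proof
    fix y assume y: "y \<in> ?S"
    show "y \<in> (\<lambda>x. b - x) ` (Y \<inter> {p<..<q}) \<union> missed_sums Y b"
    proof (cases "b - y \<in> Y")
      case True
      then have "b - y \<in> Y \<inter> {p<..<q}" using y assms by auto
      moreover have "b - (b - y) = y" using y by auto
      ultimately show ?thesis by (metis UnI1 imageI)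
    qed (use y in \<open>auto simp: missed_sums_def\<close>)
  qed
  then have "card ?S \<le> card ((\<lambda>x. b - x) ` (Y \<inter> {p<..<q})) + card (missed_sums Y b)"
    by (rule card_le_add) (auto simp: finite_missed_sums)
  also have "card ((\<lambda>x. b - x) ` (Y \<inter> {p<..<q})) \<le> fill Y p q" by (intro card_image_le) auto
  finally show ?thesis by simp
qed

text \<open>Elements of \<open>Y\<close> outside \<open>diff_pairs Y s\<close> leave
  \<open>Y\<close> when moved by \<open>s\<close>, so \<open>Y\<close> cannot be dense both on an
  interval and on its translate. \<open>fill_shift_up_le\<close> is the same with the roles of the
  intervals exchanged.\<close>

lemma fill_shift_down_le:
  assumes "finite Y"
  shows "fill Y p q \<le> hole Y (p + s) (q + s) + card (diff_pairs Y s)"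
proof -
  let ?H = "{x\<in>{p<..<q}. x + s \<notin> Y}"
  have "fill Y p q \<le> card ?H + card (diff_pairs Y s)"
    by (rule card_le_add) (use assms in \<open>auto simp: diff_pairs_def add.commute\<close>)
  also have "card ?H \<le> hole Y (p + s) (q + s)"
    by (rule card_le_of_inj[of _ "\<lambda>x. x + s"]) (auto simp: inj_on_def)
  finally show ?thesis by simp
qed

lemma fill_shift_up_le:
  assumes "finite Y"
  shows "fill Y (p + s) (q + s) \<le> hole Y p q + card (diff_pairs Y s)"
proof -
  have "fill Y (p + s) (q + s) \<le> card (({p<..<q} - Y) \<union> diff_pairs Y s)"
  proof (rule card_le_of_inj[of _ "\<lambda>x. x - s"])
    show "(\<lambda>x. x - s) ` (Y \<inter> {p + s<..<q + s}) \<subseteq> ({p<..<q} - Y) \<union> diff_pairs Y s"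
      by (auto simp: diff_pairs_def)
  qed (use assms in \<open>auto simp: inj_on_def finite_diff_pairs\<close>)
  also have "\<dots> \<le> hole Y p q + card (diff_pairs Y s)" by (rule card_Un_le)
  finally show ?thesis .
qed

section \<open>Sizes of two nested sets with few sums\<close>

locale almost_sum_free =
  fixes B C :: "nat set" and n e :: nat
  assumes BC: "B \<subseteq> C" and Cn: "C \<subseteq> {1..n}" and e: "e \<ge> 1"
    and exc: "card (exceptional B C e) \<le> e" and big: "card B > e"
begin

text \<open>\<open>a\<close> and \<open>b\<close> stand in for the minimum and maximum of
  \<open>B\<close>: at most \<open>e\<close> elements of \<open>B\<close> lie below \<open>a\<close>
  or above \<open>b\<close>, respectively, and the sparsity bounds are available for both.\<close>

definition "typical = B - exceptional B C e"
definition "a = Min typical"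
definition "b = Max typical"

lemma finC: "finite C"
  by (rule finite_subset[OF Cn]) simp

lemma finB: "finite B"
  by (rule finite_subset[OF BC finC])

lemma fin_exc: "finite (exceptional B C e)"
  using finB by (auto simp: exceptional_def)

lemma typical: "finite typical" "typical \<noteq> {}"
proof -
  show "finite typical" using finB by (simp add: typical_def)
  show "typical \<noteq> {}"
  proof
    assume "typical = {}"
    then have "B \<subseteq> exceptional B C e" by (auto simp: typical_def)
    then have "card B \<le> card (exceptional B C e)" using fin_exc by (intro card_mono)
    with exc big show False by simp
  qed
qed

lemma typicalD:
  assumes "x \<in> typical"
  shows "x \<in> B" "x \<in> C" "x \<ge> 1" "x \<le> n" "card (diff_pairs C x) \<le> e" "card (sum_pairs C x) \<le> e"
  using assms BC Cn by (auto simp: typical_def exceptional_def)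

lemma a_typical: "a \<in> typical" and b_typical: "b \<in> typical"
  using typical by (auto simp: a_def b_def)

lemma a_le: "x \<in> typical \<Longrightarrow> a \<le> x" and b_ge: "x \<in> typical \<Longrightarrow> x \<le> b"
  using typical by (auto simp: a_def b_def)

lemmas aD = typicalD[OF a_typical] and bD = typicalD[OF b_typical]

lemma a_le_b: "a \<le> b"
  using a_le b_typical by blast

lemma card_le_exc:
  assumes "S \<subseteq> B" "S \<inter> typical = {}"
  shows "card S \<le> e"
proof -
  have "S \<subseteq> exceptional B C e" using assms by (auto simp: typical_def)
  then have "card S \<le> card (exceptional B C e)" by (rule card_mono[OF fin_exc])
  with exc show ?thesis by simp
qed

lemma below_a: "card (B \<inter> {..<a}) \<le> e"
  by (rule card_le_exc) (use a_le in force)+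

lemma above_b: "card (B \<inter> {b<..}) \<le> e"
  by (rule card_le_exc) (use b_ge in force)+

lemma fill_below_a: "fill B 0 a \<le> e"
  by (rule card_le_exc) (use a_le in force)+

lemma card_sums_b: "card (sum_pairs C b \<inter> {0<..<b}) \<le> e"
  using bD(6) card_mono[of "sum_pairs C b" "sum_pairs C b \<inter> {0<..<b}"] finC by (simp add: finite_sum_pairs)

lemma fill_C_below_b: "2 * fill C 0 b \<le> b - 1 + e"
  using card_missed_sums[of C b] card_sums_b by linarith

lemma fill_B_le_C: "fill B p q \<le> fill C p q"
  using BC by (intro card_mono) auto

lemma card_B_le: "card B \<le> fill B 0 b + 1 + e"
proof -
  have "B \<subseteq> insert b (B \<inter> {0<..<b}) \<union> (B \<inter> {b<..})" using BC Cn by fastforce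
  then have "card B \<le> card (insert b (B \<inter> {0<..<b})) + card (B \<inter> {b<..})"
    using finB by (intro card_le_add) auto
  also have "card (insert b (B \<inter> {0<..<b})) \<le> fill B 0 b + 1" by (simp add: card_insert_if)
  finally show ?thesis using above_b by linarith
qed

lemma card_C_eq: "card C = fill C 0 b + 1 + fill C b (n + 1)"
proof -
  have "C = insert b (C \<inter> {0<..<b}) \<union> (C \<inter> {b<..<n + 1})" using bD Cn by fastforce
  then have "card C = card (insert b (C \<inter> {0<..<b}) \<union> (C \<inter> {b<..<n + 1}))" by simp
  also have "\<dots> = card (insert b (C \<inter> {0<..<b})) + fill C b (n + 1)"
    by (intro card_Un_disjoint) auto
  also have "card (insert b (C \<inter> {0<..<b})) = fill C 0 b + 1" by simp
  finally show ?thesis .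
qed

text \<open>As \<open>b\<close> is the sum of few pairs in \<open>C\<close>, the set
  \<open>C\<close> takes up at most about half of \<open>{0<..<b}\<close>. Below \<open>b\<close>
  both sets thus contribute at most \<open>b / 2\<close>; above \<open>b\<close> only
  \<open>C\<close> matters, with at most \<open>n - b\<close> elements.\<close>

theorem card_add_le: "card B + card C \<le> n + 3 * e"
  using card_B_le card_C_eq fill_C_below_b fill_B_le_C[where p = 0 and q = b] fill_add_hole[where Y = C and p = b and q = "n + 1"] e bD(3,4)
  by linarith

theorem card_B_ge:
  assumes "n \<le> card B + card C + e"
  shows "n \<le> 2 * card B + 24 * e"
proof -
  have B0: "b \<le> 2 * card B + 4 * e"
    using assms card_C_eq fill_C_below_b fill_add_hole[where Y = C and p = b and q = "n + 1"] e bD(3,4) by linarith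
  have hC: "hole C b (n + 1) \<le> 4 * e"
    using assms card_C_eq card_B_le fill_B_le_C[where p = 0 and q = b] fill_C_below_b fill_add_hole[where Y = C and p = b and q = "n + 1"] e bD(3,4)
    by linarith
  have "card (sum_pairs B b \<inter> {0<..<b}) \<le> e"
    using card_sums_b card_mono[of "sum_pairs C b \<inter> {0<..<b}" "sum_pairs B b \<inter> {0<..<b}"] BC
    by (force simp: sum_pairs_def)
  then have m: "card (missed_sums B b) \<le> 9 * e"
    using card_missed_sums[of B b] B0 card_B_le e bD(3) by linarith
  \<comment> \<open>\<open>B\<close> is nearly empty below \<open>a\<close>, hence nearly full on
    the mirror image at \<open>b\<close>.\<close>
  have "hole B (b - a) b \<le> 10 * e"
    using hole_reflect_le[OF a_le_b, where Y = B and p = 0] fill_below_a m by simp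
  then have "hole C (b - a) b \<le> 10 * e"
    using card_mono[of "{b - a<..<b} - B" "{b - a<..<b} - C"] BC by fastforce
  \<comment> \<open>\<open>C\<close> is thus nearly full on an interval of about
    \<open>n - b\<close> elements which the shift by the typical \<open>a\<close> carries onto
    \<open>{b<..<n + 1}\<close>, where \<open>C\<close> is nearly full as well. This is only
    possible if the interval is short.\<close>
  moreover have "hole C (b - a) (n + 1 - a) \<le> hole C (b - a) b + hole C b (n + 1)"
  proof (rule card_le_add)
    show "{b - a<..<n + 1 - a} - C \<subseteq> ({b - a<..<b} - C) \<union> ({b<..<n + 1} - C)"
    proof
      fix x assume x: "x \<in> {b - a<..<n + 1 - a} - C"
      with bD have "x \<noteq> b" "x < n + 1" by auto
      with x show "x \<in> ({b - a<..<b} - C) \<union> ({b<..<n + 1} - C)" by auto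
    qed
  qed auto
  moreover have "fill C (b - a) (n + 1 - a) \<le> hole C b (n + 1) + e"
    using fill_shift_down_le[OF finC, where p = "b - a" and q = "n + 1 - a" and s = a] aD a_le_b by simp
  ultimately have "n - b \<le> 19 * e"
    using hC fill_add_hole[where Y = C and p = "b - a" and q = "n + 1 - a"] aD bD a_le_b by linarith
  with B0 e show ?thesis by linarith
qed

end

section \<open>Stability for sets with few sums and density 1/2\<close>

locale almost_extremal = almost_sum_free B B n e for B n e +
  assumes half: "n \<le> 2 * card B + 2 * e"
begin

lemma n_le_b: "n \<le> b + 6 * e"
  using half card_B_le fill_C_below_b e bD(3) by linarith

lemma missed: "card (missed_sums B b) \<le> 6 * e"
  using card_missed_sums[of B b] card_sums_b half card_B_le e bD(3,4) by linarith

lemma hole_reflect: "q \<le> b \<Longrightarrow> hole B (b - q) (b - p) \<le> fill B p q + 6 * e"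
  using hole_reflect_le[where Y = B and p = p and q = q and b = b] missed by linarith

lemma fill_down: "s \<in> typical \<Longrightarrow> fill B p q \<le> hole B (p + s) (q + s) + e"
  using fill_shift_down_le[OF finB, where p = p and q = q and s = s] typicalD(5)[of s] by linarith

lemma fill_up: "s \<in> typical \<Longrightarrow> fill B (p + s) (q + s) \<le> hole B p q + e"
  using fill_shift_up_le[OF finB, where p = p and q = q and s = s] typicalD(5)[of s] by linarith

text \<open>Starting from the nearly full interval of length \<open>a\<close> below
  \<open>b\<close>, shifts and reflections alternately produce nearly empty and nearly full
  intervals. If \<open>b\<close> were well above \<open>2 * a\<close>, two contradictory ones would
  overlap in a long interval.\<close>

lemma n_le_2a:
  assumes a47: "a > 47 * e"
  shows "n \<le> 2 * a + 29 * e"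
proof -
  have top: "hole B (b - a) b \<le> 7 * e"
    using hole_reflect[OF a_le_b, where p = 0] fill_below_a by simp
  have "b \<le> 2 * a + 23 * e"
  proof (cases "2 * a \<le> b")
    case True
    have ii: "fill B (b - 2 * a) (b - a) \<le> 8 * e"
      using fill_down[OF a_typical, where p = "b - 2 * a" and q = "b - a"] top True by simp
    have iii: "hole B a (2 * a) \<le> 14 * e"
      using hole_reflect[where q = "b - a" and p = "b - 2 * a"] ii True by simp
    show ?thesis
    proof (cases "b \<le> 3 * a")
      case 3: True
      \<comment> \<open>The interval from \<open>a\<close> to \<open>b - a\<close> lies both in a
        nearly full and in a nearly empty one, so it has at most \<open>22 * e\<close>
        elements.\<close>
      have "hole B a (b - a) \<le> hole B a (2 * a)" using 3 by (intro hole_mono) auto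
      moreover have "fill B a (b - a) \<le> fill B (b - 2 * a) (b - a)" using 3 by (intro fill_mono) auto
      ultimately show ?thesis using ii iii fill_add_hole[where Y = B and p = a and q = "b - a"] e by linarith
    next
      case False
      \<comment> \<open>At most \<open>14 * e\<close> gaps leave more than \<open>e\<close> elements
        of \<open>B\<close> in a window of length \<open>17 * e\<close>, hence a typical
        \<open>t\<close> just below \<open>2 * a\<close>. The interval from \<open>t\<close> to
        \<open>t + a\<close> is nearly full, the one from \<open>2 * a\<close> to
        \<open>3 * a\<close> nearly empty; an overlap of at most \<open>29 * e\<close> elements
        contradicts \<open>a47\<close>.\<close>
      have "hole B (2 * a - 17 * e) (2 * a) \<le> hole B a (2 * a)"
        using a47 by (intro hole_mono) auto
      then have "fill B (2 * a - 17 * e) (2 * a) > e"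
        using iii fill_add_hole[where Y = B and p = "2 * a - 17 * e" and q = "2 * a"] e a47 by linarith
      then have "\<not> (B \<inter> {2 * a - 17 * e<..<2 * a}) \<inter> typical = {}"
        using card_le_exc[of "B \<inter> {2 * a - 17 * e<..<2 * a}"] by fastforce
      then obtain t where t: "t \<in> typical" "2 * a - 17 * e < t" "t < 2 * a" by auto
      have "fill B (b - a - t) (b - t) \<le> 8 * e"
        using fill_down[OF t(1), where p = "b - a - t" and q = "b - t"] top t False by simp
      then have "hole B t (t + a) \<le> 14 * e"
        using hole_reflect[where q = "b - t" and p = "b - a - t"] t False by (simp add: add.commute)
      moreover have "fill B (2 * a) (3 * a) \<le> 15 * e"
      proof -
        have "fill B (a + a) (2 * a + a) \<le> 15 * e"
          using fill_up[OF a_typical, where p = a and q = "2 * a"] iii by linarith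
        moreover have "a + a = 2 * a" "2 * a + a = 3 * a" by simp_all
        ultimately show ?thesis by (simp only:)
      qed
      moreover have "hole B (2 * a) (t + a) \<le> hole B t (t + a)" using t by (intro hole_mono) auto
      moreover have "fill B (2 * a) (t + a) \<le> fill B (2 * a) (3 * a)" using t by (intro fill_mono) auto
      ultimately have "t + a - 2 * a - 1 \<le> 29 * e" using fill_add_hole[where Y = B and p = "2 * a" and q = "t + a"] by linarith
      then show ?thesis using t a47 e by linarith
    qed
  qed simp
  then show ?thesis using n_le_b by linarith
qed

text \<open>Outside the upper half, \<open>B\<close> has only its few elements below
  \<open>a\<close> and the short range from \<open>a\<close> to \<open>n div 2\<close>. As
  \<open>B\<close> has nearly \<open>n / 2\<close> elements, it also leaves few gaps in the upper
  half.\<close>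

lemma near_upper_half:
  assumes "a > 47 * e"
  shows "card (B - upper_half n) \<le> 17 * e" "card (upper_half n - B) \<le> 19 * e"
proof -
  have "B - upper_half n \<subseteq> (B \<inter> {..<a}) \<union> {a..n div 2}"
    using Cn by (auto simp: upper_half_def)
  then have "card (B - upper_half n) \<le> card (B \<inter> {..<a}) + card {a..n div 2}"
    by (rule card_le_add) auto
  then show 1: "card (B - upper_half n) \<le> 17 * e"
    using below_a n_le_2a[OF assms] e by simp
  have "card (upper_half n - B) + card (upper_half n \<inter> B) = card (upper_half n)"
    by (metis add.commute card_Int_Diff finite_atLeastAtMost upper_half_def)
  moreover have "card B = card (upper_half n \<inter> B) + card (B - upper_half n)"
    using card_Int_Diff[OF finB, of "upper_half n"] by (simp add: Int_commute)
  moreover have "card (upper_half n) = n - n div 2" by (simp add: upper_half_def)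
  ultimately show "card (upper_half n - B) \<le> 19 * e" using 1 half e by linarith
qed

section \<open>Shifts that nearly preserve or nearly complement the set\<close>

text \<open>\<open>\<sigma>\<close> tells whether the shift by \<open>t\<close> is meant to complement \<open>B\<close> or to preserve it.\<close>

definition shift_err :: "bool \<Rightarrow> nat \<Rightarrow> nat set" where
  "shift_err \<sigma> t = {x\<in>{1..n - t}. ((x \<in> B) \<noteq> (x + t \<in> B)) \<noteq> \<sigma>}"

lemma finite_shift_err: "finite (shift_err \<sigma> t)"
  by (simp add: shift_err_def)

lemma card_shift_err_compl:
  "card (shift_err \<sigma> t) + card (shift_err (\<not> \<sigma>) t) = n - t"
proof -
  have "shift_err \<sigma> t \<union> shift_err (\<not> \<sigma>) t = {1..n - t}" by (auto simp: shift_err_def)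
  moreover have "shift_err \<sigma> t \<inter> shift_err (\<not> \<sigma>) t = {}" by (auto simp: shift_err_def)
  ultimately show ?thesis
    using card_Un_disjoint[OF finite_shift_err finite_shift_err, of \<sigma> t "\<not> \<sigma>" t] by simp
qed

lemma card_shift_err_zero: "card (shift_err False 0) = 0"
  by (simp add: shift_err_def)

lemma card_preimage_add_le: "finite S \<Longrightarrow> card {x. x + k \<in> S} \<le> card S" for k :: nat
  by (rule card_le_of_inj[of _ "\<lambda>x. x + k"]) auto

lemma finite_preimage_add: "finite S \<Longrightarrow> finite {x. x + k \<in> S}" for k :: nat
  by (rule finite_inverse_image) auto

text \<open>Composing shifts composes their signs, where \<open>\<noteq>\<close> on
  \<open>bool\<close> is exclusive or.\<close>

lemma card_shift_err_add:
  assumes "s + t \<le> n"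
  shows "card (shift_err (\<sigma> \<noteq> \<tau>) (s + t)) \<le> card (shift_err \<sigma> s) + card (shift_err \<tau> t)"
proof -
  have "shift_err (\<sigma> \<noteq> \<tau>) (s + t) \<subseteq> shift_err \<sigma> s \<union> {x. x + s \<in> shift_err \<tau> t}"
    using assms by (auto simp: shift_err_def add.assoc)
  then have "card (shift_err (\<sigma> \<noteq> \<tau>) (s + t)) \<le> card (shift_err \<sigma> s) + card {x. x + s \<in> shift_err \<tau> t}"
    by (rule card_le_add) (auto intro!: finite_shift_err finite_preimage_add)
  then show ?thesis using card_preimage_add_le[OF finite_shift_err, of s \<tau> t] by linarith
qed

lemma card_shift_err_diff:
  assumes "s \<le> t" "s + t \<le> n"
  shows "card (shift_err (\<sigma> \<noteq> \<tau>) (t - s)) \<le> 2 * (card (shift_err \<sigma> s) + card (shift_err \<tau> t))"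
proof -
  obtain k where k: "t = s + k" using assms(1) le_Suc_ex by blast
  let ?S = "shift_err \<sigma> s" and ?T = "shift_err \<tau> t"
  have sub: "shift_err (\<sigma> \<noteq> \<tau>) k \<subseteq>
      (?T \<union> {x. x + k \<in> ?S}) \<union> ((\<lambda>x. x + s) ` ?S \<union> (\<lambda>x. x + s) ` ?T)"
  proof
    fix x assume x: "x \<in> shift_err (\<sigma> \<noteq> \<tau>) k"
    show "x \<in> (?T \<union> {x. x + k \<in> ?S}) \<union> ((\<lambda>x. x + s) ` ?S \<union> (\<lambda>x. x + s) ` ?T)"
    \<comment> \<open>There are two routes from \<open>x\<close> to \<open>x + k\<close>: up by
      \<open>t\<close> and back by \<open>s\<close>, or, if the first leaves the range, back by
      \<open>s\<close> and up by \<open>t\<close>. In the second case \<open>s + t \<le> n\<close>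
      makes \<open>x - s\<close> positive. The two routes cause the factor 2.\<close>
    proof (cases "x + t \<le> n")
      case True
      have "x + k + s = x + t" using k by simp
      then show ?thesis using x True assms k by (auto simp: shift_err_def add_ac)
    next
      case False
      define y where "y = x - s"
      have y: "x = y + s" "y \<ge> 1" "x + k = y + t" using False assms k by (auto simp: y_def)
      have "x + k \<le> n" using x assms k by (auto simp: shift_err_def)
      then have "y \<in> ?S \<or> y \<in> ?T" using x y assms k unfolding shift_err_def by (auto simp: add.assoc)
      then show ?thesis unfolding y(1) by blast
    qed
  qed
  define m where "m = card (shift_err (\<sigma> \<noteq> \<tau>) k)"
  have "m \<le> card (?T \<union> {x. x + k \<in> ?S}) + card ((\<lambda>x. x + s) ` ?S \<union> (\<lambda>x. x + s) ` ?T)"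
    unfolding m_def using sub by (rule card_le_add) (auto intro!: finite_shift_err finite_preimage_add)
  also have "card (?T \<union> {x. x + k \<in> ?S}) \<le> card ?T + card {x. x + k \<in> ?S}"
    by (rule card_Un_le)
  also have "card {x. x + k \<in> ?S} \<le> card ?S"
    by (rule card_preimage_add_le[OF finite_shift_err])
  also have "card ((\<lambda>x. x + s) ` ?S \<union> (\<lambda>x. x + s) ` ?T) \<le> card ((\<lambda>x. x + s) ` ?S) + card ((\<lambda>x. x + s) ` ?T)"
    by (rule card_Un_le)
  also have "card ((\<lambda>x. x + s) ` ?S) \<le> card ?S"
    by (rule card_image_le[OF finite_shift_err])
  also have "card ((\<lambda>x. x + s) ` ?T) \<le> card ?T"
    by (rule card_image_le[OF finite_shift_err])
  finally have "m \<le> 2 * (card ?S + card ?T)" by simp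
  then show ?thesis by (simp add: m_def k)
qed

text \<open>Only about half of the positions next to the two ends escape the pairing
  \<open>x \<mapsto> x + s\<close>, and reflection at \<open>b\<close> counts them exactly; so the error does not grow with \<open>s\<close>.\<close>

lemma card_shift_err_typical:
  assumes s: "s \<in> typical"
  shows "card (shift_err True s) \<le> 7 * e"
proof -
  note sD = typicalD[OF s]
  have sb: "s \<le> b" using b_ge s by blast
  let ?P = "B \<inter> {1..n - s}" and ?R = "{x\<in>{1..n - s}. x + s \<in> B}"
  let ?N = "{x\<in>{1..n - s}. x \<notin> B \<and> x + s \<notin> B}"
  have "shift_err True s \<subseteq> ?N \<union> diff_pairs B s" by (auto simp: shift_err_def diff_pairs_def add.commute)
  then have 1: "card (shift_err True s) \<le> card ?N + card (diff_pairs B s)"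
    by (rule card_le_add) (auto simp: finite_diff_pairs finB)
  have "card ?N + card (?P \<union> ?R) = card {1..n - s}"
    by (rule card_complement_add) auto
  then have 2: "card ?N + card (?P \<union> ?R) = n - s" by simp
  have "card (?P \<inter> ?R) \<le> card (diff_pairs B s)"
    by (intro card_mono finite_diff_pairs finB) (auto simp: diff_pairs_def add.commute)
  then have 3: "card ?P + card ?R \<le> card (?P \<union> ?R) + e"
    using card_Un_Int[of ?P ?R] sD by simp
  have "B \<subseteq> ?P \<union> (B \<inter> {n - s<..})" using Cn by fastforce
  then have 4: "card B \<le> card ?P + card (B \<inter> {n - s<..})"
    by (rule card_le_add) (auto simp: finB)
  have "B \<subseteq> (\<lambda>x. x + s) ` ?R \<union> (B \<inter> {..s})"
  proof
    fix x assume x: "x \<in> B"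
    then have "x \<le> n" using Cn by auto
    show "x \<in> (\<lambda>x. x + s) ` ?R \<union> (B \<inter> {..s})"
    proof (cases "x \<le> s")
      case False
      then have "x - s \<in> ?R" "x = (x - s) + s" using x \<open>x \<le> n\<close> by auto
      then show ?thesis by blast
    qed (use x in simp)
  qed
  then have "card B \<le> card ((\<lambda>x. x + s) ` ?R) + card (B \<inter> {..s})"
    by (rule card_le_add) (auto simp: finB)
  then have 5: "card B \<le> card ?R + card (B \<inter> {..s})"
    using card_image_le[of ?R "\<lambda>x. x + s"] by simp
  have "B \<inter> {..s} \<subseteq> (B \<inter> {0<..<s}) \<union> {s}" using Cn by fastforce
  then have 6: "card (B \<inter> {..s}) \<le> fill B 0 s + 1"
    using card_le_add[of "B \<inter> {..s}" "B \<inter> {0<..<s}" "{s}"] by simp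
  have "B \<inter> {n - s<..} \<subseteq> insert b (B \<inter> {b - s<..<b}) \<union> (B \<inter> {b<..})" using bD(4) sb by auto
  then have "card (B \<inter> {n - s<..}) \<le> card (insert b (B \<inter> {b - s<..<b})) + card (B \<inter> {b<..})"
    by (rule card_le_add) (auto simp: finB)
  then have 7: "card (B \<inter> {n - s<..}) \<le> fill B (b - s) b + 1 + e"
    using above_b by simp
  have 8: "fill B 0 s + fill B (b - s) b \<le> s - 1 + e"
  proof -
    let ?L = "{x\<in>{0<..<s}. b - x \<in> B}"
    have "fill B (b - s) b \<le> card ?L"
      by (rule card_le_of_inj[of _ "\<lambda>x. b - x"]) (use sb in \<open>auto simp: inj_on_def\<close>)
    moreover have "fill B 0 s + card ?L = card ((B \<inter> {0<..<s}) \<union> ?L) + card ((B \<inter> {0<..<s}) \<inter> ?L)"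
      by (rule card_Un_Int) auto
    moreover have "card ((B \<inter> {0<..<s}) \<union> ?L) \<le> card {0<..<s}" by (intro card_mono) auto
    moreover have "card ((B \<inter> {0<..<s}) \<inter> ?L) \<le> card (sum_pairs B b)"
      by (intro card_mono finite_sum_pairs finB) (use sb in \<open>auto simp: sum_pairs_def\<close>)
    ultimately show ?thesis using bD(6) by simp
  qed
  show ?thesis using 1 2 3 4 5 6 7 8 sD(3-5) half e by linarith
qed


text \<open>The shift by \<open>a\<close> nearly complements \<open>B\<close>, so almost every
  \<open>x \<le> h - a\<close> has exactly one of \<open>x\<close>, \<open>x + a\<close> in
  \<open>B\<close>. For small \<open>a\<close> this gives \<open>B\<close> at least about half of
  every initial segment.\<close>

lemma card_le_two_mult_initial:
  assumes "a \<le> h" "h \<le> n"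
  shows "h \<le> 2 * card (B \<inter> {1..h}) + a + 7 * e"
proof -
  let ?P = "B \<inter> {1..h - a}" and ?R = "{x\<in>{1..h - a}. x + a \<in> B}"
  have "{1..h - a} \<subseteq> (?P \<union> ?R) \<union> shift_err True a"
    using assms by (auto simp: shift_err_def)
  then have "card {1..h - a} \<le> card (?P \<union> ?R) + card (shift_err True a)"
    by (rule card_le_add) (auto simp: finite_shift_err)
  also have "card (?P \<union> ?R) \<le> card ?P + card ?R" by (rule card_Un_le)
  also have "card ?P \<le> card (B \<inter> {1..h})" by (intro card_mono) auto
  also have "card ?R \<le> card (B \<inter> {1..h})"
    by (rule card_le_of_inj[of _ "\<lambda>x. x + a"]) (use assms in auto)
  finally show ?thesis using card_shift_err_typical[OF a_typical] by simp
qed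

text \<open>The shifts \<open>s\<close> and \<open>s - a\<close> for typical \<open>s \<le> n/2\<close> nearly fill \<open>[0, n/2]\<close>, so every small
  \<open>t\<close> is a difference of two of them.\<close>

lemma small_shift_err:
  assumes a47: "a \<le> 47 * e" and n: "n \<ge> 1000 * e" and t: "t \<le> n div 8"
  shows "\<exists>\<sigma>. card (shift_err \<sigma> t) \<le> 112 * e"
proof -
  define h where "h = n div 2"
  define S where "S = typical \<inter> {1..h}"
  \<comment> \<open>\<open>card_shift_err_diff\<close> turns two errors of \<open>7 * e\<close> into
    \<open>28 * e\<close>, and two errors of \<open>28 * e\<close> into the claimed
    \<open>112 * e\<close>.\<close>
  define T where "T = {t\<in>{..h}. \<exists>\<sigma>. card (shift_err \<sigma> t) \<le> 28 * e}"
  have finS: "finite S" and finT: "finite T" by (auto simp: S_def T_def)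
  have ah: "a \<le> h" "h \<le> n" using a47 n by (auto simp: h_def)
  have "B \<inter> {1..h} \<subseteq> S \<union> (B \<inter> {1..h} - typical)" by (auto simp: S_def)
  then have "card (B \<inter> {1..h}) \<le> card S + card (B \<inter> {1..h} - typical)"
    by (rule card_le_add) (auto simp: finS)
  moreover have "card (B \<inter> {1..h} - typical) \<le> e" by (rule card_le_exc) auto
  ultimately have cS: "h \<le> 2 * card S + a + 9 * e"
    using card_le_two_mult_initial[OF ah] by linarith
  let ?S' = "(\<lambda>s. s - a) ` S"
  have errS: "card (shift_err True s) \<le> 7 * e" if "s \<in> S" for s
    using card_shift_err_typical that by (auto simp: S_def)
  have errS': "card (shift_err False (s - a)) \<le> 28 * e" if "s \<in> S" for s
  proof -
    have "a \<le> s" "s \<le> h" using a_le that by (auto simp: S_def)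
    then have "card (shift_err (True \<noteq> True) (s - a)) \<le> 2 * (card (shift_err True a) + card (shift_err True s))"
      using ah by (intro card_shift_err_diff) (auto simp: h_def)
    then show ?thesis using errS[OF that] card_shift_err_typical[OF a_typical] by simp
  qed
  \<comment> \<open>The error sets for the two signs of one shift partition a long interval, so they
    cannot both be small.\<close>
  have "S \<inter> ?S' = {}"
  proof (rule ccontr)
    assume "S \<inter> ?S' \<noteq> {}"
    then obtain s where s: "s \<in> S" "s - a \<in> S" by auto
    have "card (shift_err True (s - a)) + card (shift_err False (s - a)) = n - (s - a)"
      using card_shift_err_compl[of True "s - a"] by simp
    moreover have "s - a \<le> h" using s by (auto simp: S_def)
    ultimately show False using errS[OF s(2)] errS'[OF s(1)] n e by (simp add: h_def)
  qed
  then have "card (S \<union> ?S') = card S + card ?S'" using finS by (intro card_Un_disjoint) auto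
  also have "card ?S' = card S"
  proof (rule card_image, rule inj_onI)
    fix x y assume "x \<in> S" "y \<in> S" and eq: "x - a = y - a"
    then have "a \<le> x" "a \<le> y" using a_le by (auto simp: S_def)
    with eq show "x = y" by simp
  qed
  finally have "card (S \<union> ?S') = 2 * card S" by simp
  moreover have "S \<union> ?S' \<subseteq> T"
  proof
    fix x assume "x \<in> S \<union> ?S'"
    then show "x \<in> T"
    proof
      assume x: "x \<in> S"
      then have "card (shift_err True x) \<le> 28 * e" using errS[of x] by linarith
      then show ?thesis using x by (auto simp: T_def S_def)
    next
      assume "x \<in> ?S'"
      then obtain s where s: "s \<in> S" "x = s - a" by auto
      then have "x \<le> h" by (auto simp: S_def)
      then show ?thesis using errS'[OF s(1)] s(2) by (auto simp: T_def)
    qed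
  qed
  ultimately have cT: "2 * card S \<le> card T" using card_mono[OF finT] by metis
  let ?U = "T \<inter> {..h - t}" and ?W = "{u\<in>{..h - t}. u + t \<in> T}"
  have th: "4 * t \<le> h" using t by (auto simp: h_def)
  have "T \<subseteq> ?U \<union> {h - t<..h}" by (auto simp: T_def)
  then have "card T \<le> card ?U + card {h - t<..h}" by (rule card_le_add) auto
  then have U: "card T \<le> card ?U + t" using th by simp
  have "T \<subseteq> (\<lambda>u. u + t) ` ?W \<union> {..<t}"
  proof
    fix x assume x: "x \<in> T"
    show "x \<in> (\<lambda>u. u + t) ` ?W \<union> {..<t}"
    proof (cases "x < t")
      case False
      then have "x - t \<in> ?W" "x = (x - t) + t" using x by (auto simp: T_def)
      then show ?thesis by blast
    qed simp
  qed
  then have "card T \<le> card ((\<lambda>u. u + t) ` ?W) + card {..<t}" by (rule card_le_add) auto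
  then have W: "card T \<le> card ?W + t" using card_image_le[of ?W "\<lambda>u. u + t"] by simp
  \<comment> \<open>Pigeonhole: \<open>T\<close> misses only O(\<open>e\<close>) elements of
    \<open>{..h}\<close> and \<open>4 * t \<le> h\<close>, so some \<open>u\<close> has both
    \<open>u\<close> and \<open>u + t\<close> in \<open>T\<close>.\<close>
  have "?U \<inter> ?W \<noteq> {}"
  proof
    assume "?U \<inter> ?W = {}"
    then have "card ?U + card ?W = card (?U \<union> ?W)" by (subst card_Un_disjoint) auto
    also have "\<dots> \<le> card {..h - t}" by (intro card_mono) auto
    finally have "card ?U + card ?W \<le> h - t + 1" by simp
    then have "4 * card S \<le> h + 1 + t" using U W cT th by linarith
    then have "8 * (2 * card S) \<le> 5 * h + 4" using th by linarith
    then have "3 * h \<le> 8 * (56 * e) + 4" using cS a47 by linarith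
    then show False using n e by (simp add: h_def)
  qed
  then obtain u where u: "u \<in> T" "u + t \<in> T" by auto
  have u3: "u + t \<le> h" using u by (auto simp: T_def)
  obtain \<sigma> \<tau> where \<sigma>: "card (shift_err \<sigma> u) \<le> 28 * e" and \<tau>: "card (shift_err \<tau> (u + t)) \<le> 28 * e"
    using u by (auto simp: T_def)
  have "card (shift_err (\<sigma> \<noteq> \<tau>) (u + t - u)) \<le> 2 * (card (shift_err \<sigma> u) + card (shift_err \<tau> (u + t)))"
    using u3 by (intro card_shift_err_diff) (auto simp: h_def)
  then have "card (shift_err (\<sigma> \<noteq> \<tau>) t) \<le> 112 * e" using \<sigma> \<tau> by simp
  then show ?thesis by blast
qed

text \<open>Errors do not accumulate in the induction: adding the shift by 1 may double the error to
  \<open>224 * e\<close>, but \<open>small_shift_err\<close> supplies some sign with error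
  \<open>112 * e\<close>, and by \<open>uniq\<close> it is the same sign.\<close>

lemma parity_shift_err:
  assumes a47: "a \<le> 47 * e" and n: "n \<ge> 1000 * e" and t: "t \<le> n div 8"
  shows "card (shift_err (odd t) t) \<le> 112 * e"
proof -
  have uniq: "\<sigma> = \<tau>" if "card (shift_err \<sigma> s) \<le> 224 * e" "card (shift_err \<tau> s) \<le> 112 * e" "s \<le> n div 8" for \<sigma> \<tau> s
  proof (rule ccontr)
    assume "\<sigma> \<noteq> \<tau>"
    then have "\<tau> = (\<not> \<sigma>)" by auto
    then show False using card_shift_err_compl[of \<sigma> s] that n e by simp
  qed
  have n8: "1 \<le> n div 8" "a \<le> n div 8" using n a47 e by auto
  obtain \<rho> where \<rho>: "card (shift_err \<rho> 1) \<le> 112 * e" using small_shift_err[OF a47 n n8(1)] by blast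
  have *: "card (shift_err (odd s \<and> \<rho>) s) \<le> 112 * e" if "s \<le> n div 8" for s
    using that
  proof (induction s)
    case 0
    then show ?case by (simp add: card_shift_err_zero)
  next
    case (Suc s)
    have "card (shift_err ((odd s \<and> \<rho>) \<noteq> \<rho>) (s + 1))
        \<le> card (shift_err (odd s \<and> \<rho>) s) + card (shift_err \<rho> 1)"
      using Suc.prems by (intro card_shift_err_add) auto
    moreover have "((odd s \<and> \<rho>) \<noteq> \<rho>) = (odd (Suc s) \<and> \<rho>)" by auto
    ultimately have "card (shift_err (odd (Suc s) \<and> \<rho>) (Suc s)) \<le> 224 * e"
      using Suc \<rho> by simp
    moreover obtain \<tau> where \<tau>: "card (shift_err \<tau> (Suc s)) \<le> 112 * e"
      using small_shift_err[OF a47 n Suc.prems] by blast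
    ultimately have "(odd (Suc s) \<and> \<rho>) = \<tau>" using Suc.prems by (intro uniq)
    then show ?case using \<tau> by simp
  qed
  \<comment> \<open>If the shift by 1 preserved \<open>B\<close>, so would the shift by
    \<open>a\<close>, which nearly complements \<open>B\<close>.\<close>
  have "\<rho>"
  proof (rule ccontr)
    assume "\<not> \<rho>"
    then have "card (shift_err False a) \<le> 112 * e" using *[OF n8(2)] by simp
    moreover have "card (shift_err True a) \<le> 224 * e"
      using card_shift_err_typical[OF a_typical] by linarith
    ultimately show False using uniq[OF _ _ n8(2)] by blast
  qed
  then show ?thesis using *[OF t] by simp
qed

text \<open>\<open>B\<close> agrees with the odd numbers on \<open>{1..q}\<close>, since it contains
  few even numbers there and yet nearly half of all. The shift by \<open>q\<close> respects parity
  up to few errors and carries this agreement through \<open>{1..n}\<close> block by block.\<close>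

lemma near_odd_part:
  assumes a47: "a \<le> 47 * e" and n: "n \<ge> 1000 * e"
  shows "card (sym_diff B (odd_part n)) \<le> 1420 * e"
proof -
  define q where "q = n div 8"
  define W where "W = sym_diff B (odd_part n)"
  have W: "x \<in> W \<longleftrightarrow> x \<in> {1..n} \<and> (x \<in> B) \<noteq> odd x" for x
    using Cn by (auto simp: W_def odd_part_def)
  have finW: "finite W" using finB by (simp add: W_def odd_part_def)
  have q: "a \<le> q" "q \<le> n" using n a47 by (auto simp: q_def)
  \<comment> \<open>A typical even \<open>x \<le> q\<close> would have small errors for both
    signs.\<close>
  have evens: "card {x\<in>B. x \<le> q \<and> even x} \<le> e"
  proof (rule card_le_exc)
    have "x \<notin> typical" if x: "x \<in> B" "x \<le> q" "even x" for x
    proof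
      assume "x \<in> typical"
      then have "card (shift_err True x) \<le> 7 * e" by (rule card_shift_err_typical)
      moreover have "card (shift_err False x) \<le> 112 * e"
        using parity_shift_err[OF a47 n, of x] x by (simp add: q_def)
      ultimately show False using card_shift_err_compl[of True x] x n e by (simp add: q_def)
    qed
    then show "{x\<in>B. x \<le> q \<and> even x} \<inter> typical = {}" by auto
  qed auto
  have odds: "card {x\<in>{1..m}. odd x} = (m + 1) div 2" for m :: nat
  proof (induction m)
    case (Suc m)
    have "{x\<in>{1..Suc m}. odd x} = (if odd (Suc m) then insert (Suc m) {x\<in>{1..m}. odd x} else {x\<in>{1..m}. odd x})"
      by (auto simp: le_Suc_eq)
    then show ?case using Suc by auto
  qed simp
  have start: "card (W \<inter> {1..q}) \<le> 30 * e"
  proof -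
    let ?E = "{x\<in>B. x \<le> q \<and> even x}" and ?D = "{x\<in>{1..q}. odd x} - B"
    have "W \<inter> {1..q} \<subseteq> ?E \<union> ?D" by (auto simp: W)
    then have 1: "card (W \<inter> {1..q}) \<le> card ?E + card ?D"
      by (rule card_le_add) (auto simp: finB)
    have "B \<inter> {1..q} \<subseteq> ?E \<union> (B \<inter> {x\<in>{1..q}. odd x})" by auto
    then have "card (B \<inter> {1..q}) \<le> card ?E + card (B \<inter> {x\<in>{1..q}. odd x})"
      by (rule card_le_add) (auto simp: finB)
    moreover have "card ?D + card (B \<inter> {x\<in>{1..q}. odd x}) = (q + 1) div 2"
      using odds[of q] card_Int_Diff[of "{x\<in>{1..q}. odd x}" B] by (simp add: Int_commute)
    ultimately show ?thesis
      using 1 evens card_le_two_mult_initial[OF q] a47 e by linarith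
  qed
  have step: "card (W \<inter> {1..m + q}) \<le> card (W \<inter> {1..m}) + 142 * e" if m: "m + q \<le> n" for m
  proof -
    have sub: "W \<inter> {1..m + q} \<subseteq> (W \<inter> {1..q}) \<union> ((\<lambda>x. x + q) ` (W \<inter> {1..m}) \<union> (\<lambda>x. x + q) ` shift_err (odd q) q)"
    proof
      fix x assume x: "x \<in> W \<inter> {1..m + q}"
      show "x \<in> (W \<inter> {1..q}) \<union> ((\<lambda>x. x + q) ` (W \<inter> {1..m}) \<union> (\<lambda>x. x + q) ` shift_err (odd q) q)"
      proof (cases "x \<le> q")
        case False
        then obtain y where y: "x = y + q" "y \<ge> 1" using less_imp_add_positive[of q x] by force
        have "y \<in> W \<inter> {1..m} \<or> y \<in> shift_err (odd q) q"
          using x y m by (auto simp: W shift_err_def)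
        then show ?thesis using y(1) by blast
      qed (use x in auto)
    qed
    have "card (W \<inter> {1..m + q}) \<le> card (W \<inter> {1..q}) + card ((\<lambda>x. x + q) ` (W \<inter> {1..m}) \<union> (\<lambda>x. x + q) ` shift_err (odd q) q)"
      using sub by (rule card_le_add) (auto simp: finite_shift_err)
    also have "card ((\<lambda>x. x + q) ` (W \<inter> {1..m}) \<union> (\<lambda>x. x + q) ` shift_err (odd q) q)
        \<le> card ((\<lambda>x. x + q) ` (W \<inter> {1..m})) + card ((\<lambda>x. x + q) ` shift_err (odd q) q)"
      by (rule card_Un_le)
    also have "card ((\<lambda>x. x + q) ` (W \<inter> {1..m})) \<le> card (W \<inter> {1..m})"
      by (intro card_image_le) auto
    also have "card ((\<lambda>x. x + q) ` shift_err (odd q) q) \<le> card (shift_err (odd q) q)"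
      by (intro card_image_le finite_shift_err)
    finally show ?thesis using start parity_shift_err[OF a47 n, of q] by (simp add: q_def)
  qed
  have chain: "card (W \<inter> {1..min n (j * q)}) \<le> j * (142 * e)" for j
  proof (induction j)
    case (Suc j)
    define m where "m = min n (Suc j * q) - q"
    have m: "m + q = min n (Suc j * q)" "m \<le> min n (j * q)" using q by (auto simp: m_def)
    have "card (W \<inter> {1..m + q}) \<le> card (W \<inter> {1..m}) + 142 * e" by (rule step) (simp add: m)
    also have "card (W \<inter> {1..m}) \<le> card (W \<inter> {1..min n (j * q)})"
      using m(2) by (intro card_mono) auto
    finally show ?case using Suc m(1) by simp
  qed simp
  \<comment> \<open>Rounding in \<open>n div 8\<close> makes 8 blocks insufficient in general; 10
    blocks suffice for the \<open>n\<close> considered.\<close>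
  have "n \<le> 10 * q" using n e by (simp add: q_def)
  then have "card (W \<inter> {1..n}) \<le> 10 * (142 * e)" using chain[of 10] by simp
  moreover have "W \<inter> {1..n} = W" by (auto simp: W)
  ultimately show ?thesis by (simp add: W_def)
qed

theorem extremal_dichotomy:
  assumes "n \<ge> 1000 * e"
  shows "card (sym_diff B (odd_part n)) \<le> 1420 * e \<or> card (sym_diff B (upper_half n)) \<le> 1420 * e"
proof (cases "a \<le> 47 * e")
  case True
  then show ?thesis using near_odd_part assms by blast
next
  case False
  have "card (sym_diff B (upper_half n)) \<le> card (B - upper_half n) + card (upper_half n - B)"
    by (rule card_Un_le)
  then show ?thesis using near_upper_half False by linarith
qed

end

section \<open>Exceptional elements and passage to supersets\<close>

lemma card_odd_part: "card (odd_part m) = (m + 1) div 2"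
proof (induction m)
  case (Suc m)
  have "odd_part (Suc m) = (if odd (Suc m) then insert (Suc m) (odd_part m) else odd_part m)"
    by (auto simp: odd_part_def le_Suc_eq)
  moreover have "Suc m \<notin> odd_part m" "finite (odd_part m)" by (auto simp: odd_part_def)
  ultimately show ?case using Suc by auto
qed (simp add: odd_part_def)

lemma exceptional_mono:
  assumes "finite Y" "Y' \<subseteq> Y" "e \<le> e'"
  shows "exceptional X Y' e' \<subseteq> exceptional X Y e"
proof -
  have "card (diff_pairs Y' x) \<le> card (diff_pairs Y x)" "card (sum_pairs Y' x) \<le> card (sum_pairs Y x)" for x
    using assms by (auto intro!: card_mono finite_diff_pairs finite_sum_pairs)
      (auto simp: diff_pairs_def sum_pairs_def)
  then show ?thesis using assms(3) unfolding exceptional_def by (auto intro: le_less_trans less_le_trans)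
qed

lemma card_sigma_ge:
  assumes "finite X" "\<And>x. x \<in> X \<Longrightarrow> finite (R x)" "\<And>x. x \<in> X \<Longrightarrow> k \<le> card (R x)"
  shows "card X * k \<le> card (Sigma X R)"
  using assms sum_bounded_below[of X k "\<lambda>x. card (R x)"] by simp

text \<open>Double counting. More than \<open>e\<close> solutions remain at least \<open>e\<close>
  after the degenerate one is removed (\<open>y = x\<close> for differences,
  \<open>y = x div 2\<close> for sums), and the factor 2 accounts for the two kinds.\<close>

lemma card_exceptional_le:
  assumes "finite X" "finite Y" "finite P"
    and diff: "\<And>x y. x \<in> X \<Longrightarrow> y \<in> Y \<Longrightarrow> x + y \<in> Y \<Longrightarrow> x \<noteq> y \<Longrightarrow> (x, y) \<in> P"
    and sum: "\<And>y z. y \<in> Y \<Longrightarrow> z \<in> Y \<Longrightarrow> y \<noteq> z \<Longrightarrow> y + z \<in> X \<Longrightarrow> (y, z) \<in> P"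
  shows "card (exceptional X Y e) * e \<le> 2 * card P"
proof -
  let ?D = "{x\<in>X. card (diff_pairs Y x) > e}" and ?S = "{x\<in>X. card (sum_pairs Y x) > e}"
  have "exceptional X Y e = ?D \<union> ?S" by (auto simp: exceptional_def)
  then have "card (exceptional X Y e) \<le> card ?D + card ?S" by (simp add: card_Un_le)
  then have "card (exceptional X Y e) * e \<le> card ?D * e + card ?S * e"
    by (metis add_mult_distrib mult_le_mono1)
  also have "card ?D * e \<le> card (Sigma ?D (\<lambda>x. diff_pairs Y x - {x}))"
    using assms(1,2) by (intro card_sigma_ge) (auto simp: finite_diff_pairs card_Diff_singleton_if)
  also have "\<dots> \<le> card P"
    by (intro card_mono assms(3)) (auto simp: diff_pairs_def intro!: diff)
  also have "card ?S * e \<le> card (Sigma ?S (\<lambda>x. sum_pairs Y x - {x div 2}))"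
    using assms(1,2) by (intro card_sigma_ge) (auto simp: finite_sum_pairs card_Diff_singleton_if)
  also have "\<dots> \<le> card P"
  proof (rule card_le_of_inj[OF assms(3), of "\<lambda>(x, y). (y, x - y)"])
    show "inj_on (\<lambda>(x, y). (y, x - y)) (Sigma ?S (\<lambda>x. sum_pairs Y x - {x div 2}))"
      by (auto simp: inj_on_def sum_pairs_def)
    show "(\<lambda>(x, y). (y, x - y)) ` Sigma ?S (\<lambda>x. sum_pairs Y x - {x div 2}) \<subseteq> P"
    proof
      fix p assume "p \<in> (\<lambda>(x, y). (y, x - y)) ` Sigma ?S (\<lambda>x. sum_pairs Y x - {x div 2})"
      then obtain x y where p: "p = (y, x - y)" "x \<in> X" "y \<in> Y" "x - y \<in> Y" "y < x" "y \<noteq> x div 2"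
        by (auto simp: sum_pairs_def)
      then have "y \<noteq> x - y" by auto
      with p show "p \<in> P" by (auto intro: sum)
    qed
  qed
  finally show ?thesis by simp
qed

text \<open>An even \<open>x\<close> is a difference of about \<open>(n - x) / 2\<close> and a sum
  of about \<open>x / 2\<close> ordered pairs of odd numbers. The larger count is about
  \<open>n / 4\<close> or more and at most \<open>2 * f\<close> of its pairs leave \<open>B\<close>,
  so an even \<open>x\<close> in \<open>A\<close> is exceptional.\<close>

lemma superset_near_odd_part:
  assumes A: "A \<subseteq> {1..n}" "B \<subseteq> A" and exc: "card (exceptional A B e) \<le> e"
    and near: "card (sym_diff B (odd_part n)) \<le> f" and n: "n \<ge> 8 * f + 4 * e + 8"
  shows "card (sym_diff A (odd_part n)) \<le> e + f"
proof -
  have finA: "finite A" using A(1) by (rule finite_subset) simp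
  have finB: "finite B" using A(2) finA by (rule finite_subset)
  let ?O = "odd_part n"
  have finO: "finite ?O" by (simp add: odd_part_def)
  have "card (?O - B) \<le> card (sym_diff B ?O)" using finB finO by (intro card_mono) auto
  then have gap: "card (?O - B) \<le> f" using near by simp
  have "A - ?O \<subseteq> exceptional A B e"
  proof
    fix x assume x: "x \<in> A - ?O"
    then have x': "x \<in> A" "even x" "x \<ge> 1" "x \<le> n" using A(1) by (auto simp: odd_part_def)
    have "card (diff_pairs B x) > e \<or> card (sum_pairs B x) > e"
    proof (cases "2 * x \<le> n")
      case True
      have "odd_part (n - x) \<subseteq> diff_pairs B x \<union> ((?O - B) \<union> {y. y + x \<in> ?O - B})"
        using x' by (auto simp: odd_part_def diff_pairs_def add.commute)
      then have "card (odd_part (n - x)) \<le> card (diff_pairs B x) + card ((?O - B) \<union> {y. y + x \<in> ?O - B})"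
        by (rule card_le_add) (auto simp: finB finO finite_diff_pairs intro!: finite_inverse_image)
      also have "card ((?O - B) \<union> {y. y + x \<in> ?O - B}) \<le> card (?O - B) + card {y. y + x \<in> ?O - B}"
        by (rule card_Un_le)
      also have "card {y. y + x \<in> ?O - B} \<le> card (?O - B)"
        by (rule card_le_of_inj[of _ "\<lambda>y. y + x"]) (auto simp: finO)
      finally have *: "(n - x + 1) div 2 \<le> card (diff_pairs B x) + 2 * f"
        using gap by (simp add: card_odd_part)
      define k where "k = (n - x + 1) div 2"
      have "n \<le> 4 * k" using True unfolding k_def by presburger
      moreover have "k \<le> card (diff_pairs B x) + 2 * f" using * by (simp add: k_def)
      ultimately have "card (diff_pairs B x) > e" using n by linarith
      then show ?thesis ..
    next
      case False
      have "odd_part (x - 1) \<subseteq> sum_pairs B x \<union> ((?O - B) \<union> (\<lambda>y. x - y) ` (?O - B))"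
      proof
        fix y assume y: "y \<in> odd_part (x - 1)"
        then have "y \<in> ?O" "x - y \<in> ?O" "y < x" "y = x - (x - y)" using x' by (auto simp: odd_part_def)
        then show "y \<in> sum_pairs B x \<union> ((?O - B) \<union> (\<lambda>y. x - y) ` (?O - B))"
          unfolding sum_pairs_def by blast
      qed
      then have "card (odd_part (x - 1)) \<le> card (sum_pairs B x) + card ((?O - B) \<union> (\<lambda>y. x - y) ` (?O - B))"
        by (rule card_le_add) (auto simp: finB finO finite_sum_pairs)
      also have "card ((?O - B) \<union> (\<lambda>y. x - y) ` (?O - B)) \<le> card (?O - B) + card ((\<lambda>y. x - y) ` (?O - B))"
        by (rule card_Un_le)
      also have "card ((\<lambda>y. x - y) ` (?O - B)) \<le> card (?O - B)"
        by (rule card_image_le) (simp add: finO)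
      finally have "x div 2 \<le> card (sum_pairs B x) + 2 * f"
        using gap x' by (simp add: card_odd_part)
      moreover have "n \<le> 4 * (x div 2) + 2" using False by presburger
      ultimately have "card (sum_pairs B x) > e" using n by linarith
      then show ?thesis ..
    qed
    with x' show "x \<in> exceptional A B e" by (simp add: exceptional_def)
  qed
  then have "card (A - ?O) \<le> e"
    using exc card_mono[of "exceptional A B e" "A - ?O"] finA by (simp add: exceptional_def)
  moreover have "card (?O - A) \<le> f"
    using gap card_mono[of "?O - B" "?O - A"] finO A(2) by fastforce
  ultimately show ?thesis using card_Un_le[of "A - ?O" "?O - A"] by linarith
qed

text \<open>An \<open>x\<close> in the lower half is a difference of about \<open>n / 2 - x\<close>
  pairs in the upper half, which makes it exceptional unless it lies within about
  \<open>2 * f + e\<close> of \<open>n div 2\<close>.\<close>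

lemma superset_near_upper_half:
  assumes A: "A \<subseteq> {1..n}" "B \<subseteq> A" and exc: "card (exceptional A B e) \<le> e"
    and near: "card (sym_diff B (upper_half n)) \<le> f"
  shows "card (sym_diff A (upper_half n)) \<le> 2 * e + 3 * f + 1"
proof -
  have finA: "finite A" using A(1) by (rule finite_subset) simp
  have finB: "finite B" using A(2) finA by (rule finite_subset)
  let ?O = "upper_half n"
  have finO: "finite ?O" by (simp add: upper_half_def)
  have "card (?O - B) \<le> card (sym_diff B ?O)" using finB finO by (intro card_mono) auto
  then have gap: "card (?O - B) \<le> f" using near by simp
  let ?m = "n - n div 2"
  have "A - ?O \<subseteq> exceptional A B e \<union> {?m - (2 * f + e)..n div 2}"
  proof
    fix x assume x: "x \<in> A - ?O"
    then have x': "x \<in> A" "x \<le> n div 2" using A(1) by (auto simp: upper_half_def)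
    show "x \<in> exceptional A B e \<union> {?m - (2 * f + e)..n div 2}"
    proof (cases "x + (2 * f + e) < ?m")
      case True
      have "{n div 2 + 1..n - x} \<subseteq> diff_pairs B x \<union> ((?O - B) \<union> {y. y + x \<in> ?O - B})"
        using x' by (auto simp: upper_half_def diff_pairs_def add.commute)
      then have "card {n div 2 + 1..n - x} \<le> card (diff_pairs B x) + card ((?O - B) \<union> {y. y + x \<in> ?O - B})"
        by (rule card_le_add) (auto simp: finB finO finite_diff_pairs intro!: finite_inverse_image)
      also have "card ((?O - B) \<union> {y. y + x \<in> ?O - B}) \<le> card (?O - B) + card {y. y + x \<in> ?O - B}"
        by (rule card_Un_le)
      also have "card {y. y + x \<in> ?O - B} \<le> card (?O - B)"
        by (rule card_le_of_inj[of _ "\<lambda>y. y + x"]) (auto simp: finO)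
      finally have "card (diff_pairs B x) > e" using gap True by simp
      then show ?thesis using x' by (simp add: exceptional_def)
    qed (use x' in auto)
  qed
  then have "card (A - ?O) \<le> card (exceptional A B e) + card {?m - (2 * f + e)..n div 2}"
    by (rule card_le_add) (auto simp: exceptional_def finA)
  then have "card (A - ?O) \<le> 2 * e + 2 * f + 1" using exc by simp
  moreover have "card (?O - A) \<le> f"
    using gap card_mono[of "?O - B" "?O - A"] finO A(2) by fastforce
  ultimately show ?thesis using card_Un_le[of "A - ?O" "?O - A"] by linarith
qed

section \<open>From containers to palettes\<close>

text \<open>Vertices are pairs of an element and a color. For positive elements a sum exceeds both
  summands, so these triples are exactly the rainbow sums.\<close>

fun rainbow_triple :: "nat \<times> nat \<Rightarrow> nat \<times> nat \<Rightarrow> nat \<times> nat \<Rightarrow> bool" where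
  "rainbow_triple (x, i) (y, j) (z, k) \<longleftrightarrow> x + y = z \<and> x \<noteq> y \<and> i \<noteq> j \<and> i \<noteq> k \<and> j \<noteq> k"

text \<open>Two members of a sum determine the third, which leaves only its color free.\<close>

lemma codegrees_rainbow_triple:
  "codegrees_le ({1..n} \<times> {1..r}) rainbow_triple r"
proof -
  have line: "card S \<le> r" if "S \<subseteq> {z} \<times> {1..r}" for S :: "(nat \<times> nat) set" and z
    using card_mono[OF _ that] by (simp add: card_cartesian_product)
  have "card {w\<in>{1..n} \<times> {1..r}. rainbow_triple u v w} \<le> r" for u v
    by (cases u, cases v, rule line[of _ "fst u + fst v"]) auto
  moreover have "card {w\<in>{1..n} \<times> {1..r}. rainbow_triple u w v} \<le> r" for u v
    by (cases u, cases v, rule line[of _ "fst v - fst u"]) auto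
  moreover have "card {w\<in>{1..n} \<times> {1..r}. rainbow_triple w u v} \<le> r" for u v
    by (cases u, cases v, rule line[of _ "fst v - fst u"]) auto
  ultimately show ?thesis by (simp add: codegrees_le_def)
qed

text \<open>Choose greedily, the smallest palette first.\<close>

lemma ex_distinct_representatives:
  assumes "card P \<ge> 3" "card Q \<ge> 2" "R \<noteq> {}"
  shows "\<exists>p\<in>P. \<exists>q\<in>Q. \<exists>s\<in>R. p \<noteq> q \<and> p \<noteq> s \<and> q \<noteq> s"
proof -
  obtain s where s: "s \<in> R" using assms(3) by blast
  have "\<not> Q \<subseteq> {s}" using assms(2) card_mono[of "{s}" Q] by auto
  then obtain q where q: "q \<in> Q" "q \<noteq> s" by blast
  have "\<not> P \<subseteq> {q, s}" using assms(1) card_mono[of "{q, s}" P] q by auto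
  then obtain p where "p \<in> P" "p \<noteq> q" "p \<noteq> s" by blast
  with s q show ?thesis by blast
qed

lemma ex_distinct_representatives_perm:
  assumes ne: "X \<noteq> {}" "Y \<noteq> {}" "Z \<noteq> {}"
    and "card X \<ge> 3 \<and> card Y \<ge> 2 \<or> card X \<ge> 3 \<and> card Z \<ge> 2 \<or> card Y \<ge> 3 \<and> card X \<ge> 2
      \<or> card Y \<ge> 3 \<and> card Z \<ge> 2 \<or> card Z \<ge> 3 \<and> card X \<ge> 2 \<or> card Z \<ge> 3 \<and> card Y \<ge> 2"
  shows "\<exists>i\<in>X. \<exists>j\<in>Y. \<exists>k\<in>Z. i \<noteq> j \<and> i \<noteq> k \<and> j \<noteq> k"
proof -
  note sdr = ex_distinct_representatives
  from assms(4) show ?thesis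
  proof (elim disjE conjE)
    assume "card X \<ge> 3" "card Y \<ge> 2" from sdr[OF this ne(3)] show ?thesis by metis
  next
    assume "card X \<ge> 3" "card Z \<ge> 2" from sdr[OF this ne(2)] show ?thesis by metis
  next
    assume "card Y \<ge> 3" "card X \<ge> 2" from sdr[OF this ne(3)] show ?thesis by metis
  next
    assume "card Y \<ge> 3" "card Z \<ge> 2" from sdr[OF this ne(1)] show ?thesis by metis
  next
    assume "card Z \<ge> 3" "card X \<ge> 2" from sdr[OF this ne(2)] show ?thesis by metis
  next
    assume "card Z \<ge> 3" "card Y \<ge> 2" from sdr[OF this ne(1)] show ?thesis by metis
  qed
qed

lemma graph_independent:
  assumes "c \<in> A \<rightarrow>\<^sub>E {1..r}" "rainbow_sum_free A c"
  shows "triples_in rainbow_triple ((\<lambda>x. (x, c x)) ` A) = {}"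
proof -
  have False if uvw: "(u, v, w) \<in> triples_in rainbow_triple ((\<lambda>x. (x, c x)) ` A)" for u v w
  proof -
    obtain x y z where xyz: "u = (x, c x)" "v = (y, c y)" "w = (z, c z)" "x \<in> A" "y \<in> A" "z \<in> A"
      and T: "rainbow_triple u v w"
      using uvw unfolding triples_in_def by blast
    then have "rainbow_sum A c x y z" by (auto simp: rainbow_sum_def)
    then show False using assms(2) by (auto simp: rainbow_sum_free_def)
  qed
  then show ?thesis by auto
qed

lemma prod_palette_le:
  fixes s :: "nat \<Rightarrow> nat"
  assumes "finite A" "\<And>x. x \<in> A \<Longrightarrow> s x \<le> r" "r \<ge> 2"
  defines "B \<equiv> {x\<in>A. s x \<ge> 3}" and "C \<equiv> {x\<in>A. s x \<ge> 2}"
  shows "(\<Prod>x\<in>A. s x) \<le> r ^ card B * 2 ^ (card C - card B)"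
proof -
  have BC: "B \<subseteq> C" "C \<subseteq> A" by (auto simp: B_def C_def)
  have finC: "finite C" and finB: "finite B" using assms(1) by (auto simp: B_def C_def)
  have "(\<Prod>x\<in>A. s x) = (\<Prod>x\<in>A - C. s x) * ((\<Prod>x\<in>C - B. s x) * (\<Prod>x\<in>B. s x))"
    using prod.subset_diff[OF BC(2) assms(1), of s] prod.subset_diff[OF BC(1) finC, of s] by simp
  also have "\<dots> \<le> 1 * (2 ^ card (C - B) * r ^ card B)"
  proof (intro mult_le_mono)
    show "(\<Prod>x\<in>A - C. s x) \<le> 1" by (rule prod_le_1) (auto simp: C_def)
    show "(\<Prod>x\<in>C - B. s x) \<le> 2 ^ card (C - B)"
    proof -
      have "(\<Prod>x\<in>C - B. s x) \<le> (\<Prod>x\<in>C - B. 2)" by (rule prod_mono) (auto simp: B_def C_def)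
      then show ?thesis by simp
    qed
    show "(\<Prod>x\<in>B. s x) \<le> r ^ card B"
    proof -
      have "(\<Prod>x\<in>B. s x) \<le> (\<Prod>x\<in>B. r)" by (rule prod_mono) (use assms(2) in \<open>auto simp: B_def\<close>)
      then show ?thesis by simp
    qed
  qed
  also have "card (C - B) = card C - card B" using BC finB by (simp add: card_Diff_subset)
  finally show ?thesis by (simp add: mult.commute)
qed

text \<open>\<open>B\<close> and \<open>C\<close> consist of the elements with at least 3 and at
  least 2 colors in the container admitting the most colorings. The term \<open>\<zeta> * n\<close>
  in the exponent pays for the number of containers, and \<open>e\<close> is
  \<open>\<zeta> * n\<close> rounded down.\<close>

lemma structure_of_many_colorings:
  fixes r :: nat and \<zeta> :: real
  assumes r: "r \<ge> 2" and \<zeta>: "\<zeta> > 0"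
  obtains n\<^sub>0 where "\<And>n A. n \<ge> n\<^sub>0 \<Longrightarrow> A \<subseteq> {1..n} \<Longrightarrow> g_set A r > 0 \<Longrightarrow>
    \<exists>B C e. B \<subseteq> C \<and> C \<subseteq> A \<and> e \<ge> 1 \<and> real e \<le> \<zeta> * real n \<and> \<zeta> * real n \<le> real e + 1
      \<and> card (exceptional B C e) \<le> e \<and> card (exceptional A B e) \<le> e
      \<and> real (g_set A r) \<le> real r powr (\<zeta> * real n + card B + log r 2 * (real (card C) - real (card B)))"
proof -
  \<comment> \<open>With \<open>card V = n * r\<close>, these choices give
    \<open>\<kappa> * card V ^ 2 = (\<zeta> * n) ^ 2 / 8\<close>, which is at most
    \<open>e ^ 2 / 2\<close>, and
    \<open>exp (\<gamma> * card V) = r powr (\<zeta> * n)\<close>.\<close>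
  define \<kappa> where "\<kappa> = \<zeta> ^ 2 / (8 * real r ^ 2)"
  define \<gamma> where "\<gamma> = \<zeta> * ln r / r"
  have \<kappa>: "\<kappa> > 0" and \<gamma>: "\<gamma> > 0" using r \<zeta> by (auto simp: \<kappa>_def \<gamma>_def)
  have r1: "r \<ge> 1" using r by simp
  obtain N0 where N0: "\<forall>(V :: (nat \<times> nat) set) T. finite V \<and> card V \<ge> N0 \<and> codegrees_le V T r \<longrightarrow>
    (\<exists>\<F>. finite \<F> \<and> real (card \<F>) \<le> exp (\<gamma> * real (card V))
    \<and> (\<forall>F\<in>\<F>. F \<subseteq> V \<and> real (card (triples_in T F)) < \<kappa> * real (card V) ^ 2)
    \<and> (\<forall>I\<subseteq>V. triples_in T I = {} \<longrightarrow> (\<exists>F\<in>\<F>. I \<subseteq> F)))"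
    using triple_containers[OF \<kappa> \<gamma> r1, where 'a = "nat \<times> nat"] by (elim exE) (rule that)
  \<comment> \<open>The second bound ensures \<open>\<zeta> * n \<ge> 2\<close>, hence
    \<open>e \<ge> 1\<close> and \<open>\<zeta> * n \<le> 2 * e\<close>.\<close>
  define n0 where "n0 = max N0 (nat \<lceil>2 / \<zeta>\<rceil>)"
  show ?thesis
  proof (rule that[of n0])
    fix n A assume n: "n \<ge> n0" and A: "A \<subseteq> {1..n}" and g: "g_set A r > 0"
    define V where "V = {1..n} \<times> {1..r}"
    have cV: "card V = n * r" by (simp add: V_def)
    have "N0 \<le> card V" using n r1 cV unfolding n0_def
      by (metis le_trans max.boundedE mult_le_mono2 mult.right_neutral)
    moreover have "finite V" by (simp add: V_def)
    moreover have "codegrees_le V rainbow_triple r" unfolding V_def by (rule codegrees_rainbow_triple)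
    ultimately have "finite V \<and> N0 \<le> card V \<and> codegrees_le V rainbow_triple r" by simp
    then obtain \<F> where \<F>: "finite \<F>" "real (card \<F>) \<le> exp (\<gamma> * real (card V))"
      "\<forall>F\<in>\<F>. F \<subseteq> V \<and> real (card (triples_in rainbow_triple F)) < \<kappa> * real (card V) ^ 2"
      "\<forall>I\<subseteq>V. triples_in rainbow_triple I = {} \<longrightarrow> (\<exists>F\<in>\<F>. I \<subseteq> F)"
      by (rule N0[rule_format, THEN exE]) (elim conjE, rule that)
    have finA: "finite A" using A by (rule finite_subset) simp
    define G where "G = {c \<in> A \<rightarrow>\<^sub>E {1..r}. rainbow_sum_free A c}"
    define p where "p F = (\<Prod>x\<in>A. card (F `` {x}))" for F :: "(nat \<times> nat) set"
    have finF: "finite (F `` {x})" if "F \<in> \<F>" for F x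
    proof -
      have "F `` {x} \<subseteq> {1..r}" using \<F>(3) that by (auto simp: V_def)
      then show ?thesis by (rule finite_subset) simp
    qed
    have GF: "G \<subseteq> (\<Union>F\<in>\<F>. PiE A (\<lambda>x. F `` {x}))"
    proof
      fix c assume c: "c \<in> G"
      let ?I = "(\<lambda>x. (x, c x)) ` A"
      have "?I \<subseteq> V" using c A by (auto simp: G_def V_def)
      moreover have "triples_in rainbow_triple ?I = {}"
        using c graph_independent by (auto simp: G_def)
      ultimately obtain F where F: "F \<in> \<F>" "?I \<subseteq> F" using \<F>(4) by auto
      then have "c \<in> PiE A (\<lambda>x. F `` {x})" using c by (auto simp: G_def PiE_def)
      with F show "c \<in> (\<Union>F\<in>\<F>. PiE A (\<lambda>x. F `` {x}))" by blast
    qed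
    have "card G \<le> card (\<Union>F\<in>\<F>. PiE A (\<lambda>x. F `` {x}))"
      by (intro card_mono GF finite_UN_I \<F> finite_PiE finA finF)
    also have "\<dots> \<le> (\<Sum>F\<in>\<F>. card (PiE A (\<lambda>x. F `` {x})))" by (intro card_UN_le \<F>)
    also have "\<dots> = (\<Sum>F\<in>\<F>. p F)" by (simp add: card_PiE[OF finA] p_def)
    finally have gsum: "g_set A r \<le> (\<Sum>F\<in>\<F>. p F)" by (simp add: g_set_def G_def)
    have "\<F> \<noteq> {}" using gsum g by auto
    then have "Max (p ` \<F>) \<in> p ` \<F>" using \<F>(1) by (intro Max_in) auto
    then obtain F where FM: "F \<in> \<F>" "p F = Max (p ` \<F>)" by auto
    have F: "F \<in> \<F>" "\<And>F'. F' \<in> \<F> \<Longrightarrow> p F' \<le> p F"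
      using FM \<F>(1) by auto
    have gp: "g_set A r \<le> card \<F> * p F"
      using gsum sum_bounded_above[of \<F> p "p F"] F(2) by (simp add: le_trans)
    then have "p F > 0" using g by (cases "p F") auto
    then have ne: "F `` {x} \<noteq> {}" if "x \<in> A" for x
      using that finA by (auto simp: p_def prod_zero_iff)
    define B where "B = {x\<in>A. card (F `` {x}) \<ge> 3}"
    define C where "C = {x\<in>A. card (F `` {x}) \<ge> 2}"
    have BC: "B \<subseteq> C" "C \<subseteq> A" by (auto simp: B_def C_def)
    have finC: "finite C" and finB: "finite B" using finA by (auto simp: B_def C_def)
    \<comment> \<open>The pairs of summands that can be completed to a rainbow sum inside
      \<open>F\<close>. Each comes from a triple in \<open>F\<close>, so there are few.\<close>
    define P where "P = {(x, y). x \<in> A \<and> y \<in> A \<and> x + y \<in> A \<and> x \<noteq> y \<and>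
      (\<exists>i\<in>F `` {x}. \<exists>j\<in>F `` {y}. \<exists>k\<in>F `` {x + y}. i \<noteq> j \<and> i \<noteq> k \<and> j \<noteq> k)}"
    have finP: "finite P" by (rule finite_subset[of _ "A \<times> A"]) (auto simp: P_def finA)
    have "F \<subseteq> V" using \<F>(3) F(1) by blast
    then have fin: "finite F" by (rule finite_subset) (simp add: V_def)
    have "P \<subseteq> (\<lambda>(u, v, w). (fst u, fst v)) ` triples_in rainbow_triple F"
    proof
      fix q assume "q \<in> P"
      then obtain x y i j k where q: "q = (x, y)" "x \<noteq> y" "i \<noteq> j" "i \<noteq> k" "j \<noteq> k"
        "(x, i) \<in> F" "(y, j) \<in> F" "(x + y, k) \<in> F"
        by (auto simp: P_def)
      then have "((x, i), (y, j), (x + y, k)) \<in> triples_in rainbow_triple F"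
        by (simp add: triples_in_def)
      then show "q \<in> (\<lambda>(u, v, w). (fst u, fst v)) ` triples_in rainbow_triple F"
        by (rule rev_image_eqI) (simp add: q(1))
    qed
    then have "card P \<le> card (triples_in rainbow_triple F)"
      using finite_triples_in[OF fin] by (rule surj_card_le[rotated])
    then have cP: "real (card P) < \<kappa> * real (card V) ^ 2"
      using \<F>(3) F(1) by (meson le_less_trans of_nat_le_iff)
    define e where "e = nat \<lfloor>\<zeta> * n\<rfloor>"
    have e0: "\<zeta> * n \<ge> 2"
    proof -
      have "2 / \<zeta> \<le> real n" using n unfolding n0_def by linarith
      then show ?thesis using \<zeta> by (simp add: field_simps)
    qed
    then have e: "e \<ge> 1" "real e \<le> \<zeta> * n" "\<zeta> * n \<le> real e + 1" "\<zeta> * n \<le> 2 * real e"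
      unfolding e_def by linarith+
    have "(\<zeta> * n) ^ 2 \<le> (2 * real e) ^ 2" using e(4) e0 by (intro power_mono) auto
    moreover have "\<kappa> * real (card V) ^ 2 = (\<zeta> * n) ^ 2 / 8"
      using r by (simp add: \<kappa>_def cV power_mult_distrib field_simps)
    ultimately have "2 * real (card P) \<le> real e ^ 2" using cP by (simp add: power_mult_distrib)
    then have P2: "2 * card P \<le> e * e"
      by (simp add: power2_eq_square flip: of_nat_mult)
    have P_intro: "(x, y) \<in> P" if "x \<in> A" "y \<in> A" "x + y \<in> A" "x \<noteq> y"
      "x \<in> B \<and> y \<in> C \<or> x \<in> B \<and> x + y \<in> C \<or> y \<in> B \<and> x \<in> C \<or> y \<in> B \<and> x + y \<in> C
        \<or> x + y \<in> B \<and> x \<in> C \<or> x + y \<in> B \<and> y \<in> C" for x y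
    proof -
      let ?X = "F `` {x}" and ?Y = "F `` {y}" and ?Z = "F `` {x + y}"
      have "\<exists>i\<in>?X. \<exists>j\<in>?Y. \<exists>k\<in>?Z. i \<noteq> j \<and> i \<noteq> k \<and> j \<noteq> k"
        by (rule ex_distinct_representatives_perm) (use that ne in \<open>auto simp: B_def C_def\<close>)
      with that(1-4) show ?thesis by (simp add: P_def)
    qed
    have "card (exceptional B C e) * e \<le> 2 * card P"
      by (rule card_exceptional_le[OF finB finC finP]; rule P_intro) (use BC in auto)
    with P2 have excC: "card (exceptional B C e) \<le> e"
      using e(1) by (metis le_trans mult_le_cancel2 not_one_le_zero gr0I)
    have "card (exceptional A B e) * e \<le> 2 * card P"
      by (rule card_exceptional_le[OF finA finB finP]; rule P_intro) (use BC in auto)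
    with P2 have excA: "card (exceptional A B e) \<le> e"
      using e(1) by (metis le_trans mult_le_cancel2 not_one_le_zero gr0I)
    have pal_le: "card (F `` {x}) \<le> r" for x
    proof -
      have "F `` {x} \<subseteq> {1..r}" using \<open>F \<subseteq> V\<close> by (auto simp: V_def)
      from card_mono[OF _ this] show ?thesis by simp
    qed
    have "p F \<le> r ^ card B * 2 ^ (card C - card B)"
      unfolding p_def B_def C_def by (rule prod_palette_le[OF finA pal_le r])
    then have "real (p F) \<le> real (r ^ card B * 2 ^ (card C - card B))" by (rule of_nat_mono)
    then have "real (p F) \<le> real r ^ card B * 2 ^ (card C - card B)" by simp
    also have "\<dots> = real r powr (card B + log r 2 * (real (card C) - real (card B)))"
    proof -
      have "(2::real) ^ (card C - card B) = 2 powr (real (card C) - real (card B))"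
        using card_mono[OF finC BC(1)] by (simp add: powr_realpow[symmetric] of_nat_diff)
      also have "\<dots> = (real r powr log r 2) powr (real (card C) - real (card B))"
      proof -
        have "real r powr log r 2 = 2" using r by simp
        then show ?thesis by (simp only:)
      qed
      also have "\<dots> = real r powr (log r 2 * (real (card C) - real (card B)))" by (rule powr_powr)
      finally show ?thesis using r by (simp add: powr_add powr_realpow)
    qed
    finally have pF: "real (p F) \<le> real r powr (card B + log r 2 * (real (card C) - real (card B)))" .
    have "exp (\<gamma> * real (card V)) = real r powr (\<zeta> * n)"
      using r by (simp add: \<gamma>_def cV powr_def field_simps)
    then have "real (card \<F>) * real (p F) \<le>
        real r powr (\<zeta> * n) * real r powr (card B + log r 2 * (real (card C) - real (card B)))"
      using \<F>(2) pF by (intro mult_mono) auto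
    also have "\<dots> = real r powr (\<zeta> * n + card B + log r 2 * (real (card C) - real (card B)))"
      by (simp add: powr_add)
    finally have "real (card \<F>) * real (p F) \<le> real r powr (\<zeta> * n + card B + log r 2 * (real (card C) - real (card B)))" .
    moreover have "real (g_set A r) \<le> real (card \<F>) * real (p F)" using of_nat_mono[OF gp, where 'a = real] by simp
    ultimately have "real (g_set A r) \<le> real r powr (\<zeta> * n + card B + log r 2 * (real (card C) - real (card B)))" by linarith
    then show "\<exists>B C e. B \<subseteq> C \<and> C \<subseteq> A \<and> e \<ge> 1 \<and> real e \<le> \<zeta> * real n \<and> \<zeta> * real n \<le> real e + 1
      \<and> card (exceptional B C e) \<le> e \<and> card (exceptional A B e) \<le> e
      \<and> real (g_set A r) \<le> real r powr (\<zeta> * real n + card B + log r 2 * (real (card C) - real (card B)))"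
      using BC e(1-3) excA excC by (intro exI[of _ B] exI[of _ C] exI[of _ e] conjI)
  qed
qed

section \<open>Extremal exponent and stability\<close>

text \<open>A sum of two odd numbers is even, so every coloring is rainbow sum-free.\<close>

lemma g_set_odd_part: "g_set (odd_part n) r = r ^ ((n + 1) div 2)"
proof -
  have "rainbow_sum_free (odd_part n) c" for c
    by (auto simp: rainbow_sum_free_def rainbow_sum_def odd_part_def)
  then have "g_set (odd_part n) r = card (odd_part n \<rightarrow>\<^sub>E {1..r})" by (simp add: g_set_def)
  also have "\<dots> = r ^ card (odd_part n)" by (simp add: card_PiE odd_part_def)
  finally show ?thesis by (simp only: card_odd_part)
qed

text \<open>Amounts to \<open>2 \<le> sqrt r\<close>: a second color is worth at most half an
  element with all \<open>r\<close> colors. Strictness for \<open>r \<ge> 5\<close> is what later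
  rules out \<open>A\<close> near \<open>{1..n}\<close>.\<close>

lemma log_two_le_half: "r \<ge> 4 \<Longrightarrow> log (real r) 2 \<le> 1 / 2"
  by (subst log_le_iff) (auto simp: powr_half_sqrt intro!: real_le_rsqrt)

lemma log_two_less_half: "r \<ge> 5 \<Longrightarrow> log (real r) 2 < 1 / 2"
  by (subst log_less_iff) (auto simp: powr_half_sqrt intro!: real_less_rsqrt)

lemma log_four_two: "log 4 2 = (1 / 2 :: real)"
  using ln_realpow[of 2 2] by (simp add: log_def)

text \<open>Serves to enlarge the error and to replace \<open>C\<close> by \<open>B\<close> itself,
  as the stability argument requires.\<close>

lemma almost_sum_free_mono:
  assumes "B \<subseteq> C" "C \<subseteq> {1..n}" "card (exceptional B C e) \<le> e" "e \<ge> 1"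
    and "C' \<subseteq> C" "B \<subseteq> C'" "e \<le> e'" "card B > e'"
  shows "almost_sum_free B C' n e'"
proof
  have finC: "finite C" using assms(2) by (rule finite_subset) simp
  have finB: "finite B" using assms(1) finC by (rule finite_subset)
  have "card (exceptional B C' e') \<le> card (exceptional B C e)"
    using finB by (intro card_mono exceptional_mono finC assms) (auto simp: exceptional_def)
  then show "card (exceptional B C' e') \<le> e'" using assms by linarith
qed (use assms in auto)

lemma g_set_upper:
  assumes r: "r \<ge> 4" and \<eta>: "\<eta> > 0"
  shows "\<exists>n\<^sub>0. \<forall>n\<ge>n\<^sub>0. \<forall>A\<subseteq>{1..n}. real (g_set A r) \<le> real r powr (real n / 2 + \<eta> * real n)"
proof -
  define L where "L = log r 2"
  have L: "0 \<le> L" "L \<le> 1 / 2" using log_two_le_half[OF r] r by (auto simp: L_def)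
  have r2: "r \<ge> 2" and \<eta>4: "\<eta> / 4 > 0" using r \<eta> by auto
  obtain n0 where n0: "\<And>n A. n \<ge> n0 \<Longrightarrow> A \<subseteq> {1..n} \<Longrightarrow> g_set A r > 0 \<Longrightarrow>
    \<exists>B C e. B \<subseteq> C \<and> C \<subseteq> A \<and> e \<ge> 1 \<and> real e \<le> \<eta> / 4 * real n \<and> \<eta> / 4 * real n \<le> real e + 1
      \<and> card (exceptional B C e) \<le> e \<and> card (exceptional A B e) \<le> e
      \<and> real (g_set A r) \<le> real r powr (\<eta> / 4 * real n + card B + log r 2 * (real (card C) - real (card B)))"
    by (rule structure_of_many_colorings[OF r2 \<eta>4]) blast
  have "real (g_set A r) \<le> real r powr (real n / 2 + \<eta> * real n)" if n: "n \<ge> n0" and A: "A \<subseteq> {1..n}" for n A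
  proof (cases "g_set A r = 0")
    case False
    then obtain B C e where BC: "B \<subseteq> C" "C \<subseteq> A" and e: "e \<ge> 1" "real e \<le> \<eta> / 4 * n"
      and exc: "card (exceptional B C e) \<le> e"
      and g: "real (g_set A r) \<le> real r powr (\<eta> / 4 * real n + card B + log r 2 * (real (card C) - real (card B)))"
      using n0[OF n A] by auto
    have Cn: "C \<subseteq> {1..n}" using BC A by blast
    have cC: "card C \<le> n" using card_mono[OF _ Cn] by simp
    have "finite C" using Cn by (rule finite_subset) simp
    then have cBC: "card B \<le> card C" using BC(1) by (rule card_mono)
    \<comment> \<open>As \<open>L \<le> 1 / 2\<close>, the left side is at most
      \<open>(card B + card C) / 2\<close>. For large \<open>B\<close> this is controlled by
      \<open>card_add_le\<close>; for small \<open>B\<close> it is nearly at most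
      \<open>n / 2\<close> anyway.\<close>
    have "card B + L * (real (card C) - real (card B)) \<le> n / 2 + \<eta> * n / 2"
    proof (cases "card B > e")
      case True
      have "almost_sum_free B C n e"
        by (rule almost_sum_free_mono[OF BC(1) Cn exc e(1) subset_refl BC(1) le_refl True])
      then have "card B + card C \<le> n + 3 * e" by (rule almost_sum_free.card_add_le)
      then have "real (card B) + card C \<le> n + 3 * e" by linarith
      moreover have "L * (real (card C) - real (card B)) \<le> 1 / 2 * (real (card C) - real (card B))"
        using L cBC by (intro mult_right_mono) auto
      ultimately show ?thesis using e(2) \<eta> by (simp add: field_simps)
    next
      case False
      have "L * (real (card C) - real (card B)) \<le> 1 / 2 * real n"
        using L cBC cC by (intro mult_mono) auto
      then show ?thesis using e(2) False \<eta> by (simp add: field_simps)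
    qed
    then have "\<eta> / 4 * real n + card B + log r 2 * (real (card C) - real (card B)) \<le> n / 2 + \<eta> * n"
    proof -
      have "0 \<le> \<eta> * n" "\<eta> / 4 * n = \<eta> * n / 4" using \<eta> by simp_all
      with \<open>card B + L * (real (card C) - real (card B)) \<le> n / 2 + \<eta> * n / 2\<close> show ?thesis
        unfolding L_def by linarith
    qed
    then have "real r powr (\<eta> / 4 * real n + card B + log r 2 * (real (card C) - real (card B)))
        \<le> real r powr (n / 2 + \<eta> * n)" using r by (intro powr_mono) auto
    with g show ?thesis by linarith
  qed simp
  then show ?thesis by blast
qed

lemma g_max_le: 
  assumes "\<And>A. A \<subseteq> {1..n} \<Longrightarrow> real (g_set A r) \<le> x"
  shows "real (g_max n r) \<le> x"
proof -
  have "g_max n r \<in> (\<lambda>A. g_set A r) ` Pow {1..n}"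
    unfolding g_max_def by (intro Max_in) auto
  with assms show ?thesis by auto
qed

lemma g_max_ge: "A \<subseteq> {1..n} \<Longrightarrow> g_set A r \<le> g_max n r"
  unfolding g_max_def by (intro Max_ge) auto

lemma g_max_ge_powr:
  assumes "r \<ge> 1"
  shows "real r powr (real n / 2) \<le> real (g_max n r)"
proof -
  have "real r powr (real n / 2) \<le> real r powr real ((n + 1) div 2)"
    using assms by (intro powr_mono) linarith+
  also have "\<dots> = real (g_set (odd_part n) r)"
    using assms by (simp add: g_set_odd_part powr_realpow)
  also have "\<dots> \<le> real (g_max n r)"
    by (intro of_nat_mono g_max_ge) (auto simp: odd_part_def)
  finally show ?thesis .
qed

lemma g_max_exponent:
  assumes r: "r \<ge> 4"
  shows "\<exists>h \<in> o(\<lambda>n::nat. real n). \<forall>n. real (g_max n r) = real r powr (real n / 2 + h n)"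
proof
  define h where "h n = log r (g_max n r) - real n / 2" for n
  have pos: "real (g_max n r) > 0" for n
  proof -
    have "0 < real r powr (real n / 2)" using r by simp
    also have "\<dots> \<le> real (g_max n r)" using r by (intro g_max_ge_powr) simp
    finally show ?thesis .
  qed
  show "\<forall>n. real (g_max n r) = real r powr (real n / 2 + h n)"
    using pos r by (simp add: h_def)
  show "h \<in> o(\<lambda>n. real n)"
  proof (rule landau_o.smallI)
    fix c :: real assume c: "c > 0"
    obtain n0 where n0: "\<And>n A. n \<ge> n0 \<Longrightarrow> A \<subseteq> {1..n} \<Longrightarrow>
        real (g_set A r) \<le> real r powr (real n / 2 + c * real n)"
      using g_set_upper[OF r c] by blast
    show "eventually (\<lambda>n. norm (h n) \<le> c * norm (real n)) sequentially"
      unfolding eventually_sequentially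
    proof (intro exI[of _ n0] allI impI)
      fix n assume n: "n \<ge> n0"
      have "real n / 2 \<le> log r (g_max n r)"
        using pos[of n] r g_max_ge_powr[of r n] by (subst le_log_iff) auto
      moreover have "log r (g_max n r) \<le> real n / 2 + c * real n"
        using pos[of n] r g_max_le[OF n0[OF n]] by (subst log_le_iff) auto
      ultimately show "norm (h n) \<le> c * norm (real n)" by (simp add: h_def)
    qed
  qed
qed

text \<open>The errors grow from \<open>e\<close> to \<open>8 * e\<close>, then by
  \<open>card_B_ge\<close> to \<open>24 * 8 * e = 192 * e\<close>, then by
  \<open>extremal_dichotomy\<close> to \<open>1420 * 192 * e = 272640 * e\<close>; the passage from
  \<open>B\<close> to \<open>A\<close> at most triples this, up to small terms.\<close>

lemma stability_of_large_exponent: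
  assumes BC: "B \<subseteq> C" "C \<subseteq> A" and A: "A \<subseteq> {1..n}" and e: "e \<ge> 1"
    and sparse: "card (exceptional B C e) \<le> e" "card (exceptional A B e) \<le> e"
    and B: "card B > 8 * e" and large: "n \<le> card B + card C + 8 * e" and n: "n \<ge> 10 ^ 7 * e"
  shows "card (sym_diff A (odd_part n)) \<le> 10 ^ 6 * e \<or> card (sym_diff A (upper_half n)) \<le> 10 ^ 6 * e"
proof -
  have Cn: "C \<subseteq> {1..n}" using BC A by blast
  interpret C: almost_sum_free B C n "8 * e"
    by (rule almost_sum_free_mono[OF BC(1) Cn sparse(1) e]) (use B BC in auto)
  have half: "n \<le> 2 * card B + 192 * e" using C.card_B_ge large by simp
  interpret E: almost_extremal B n "192 * e"
  proof (intro almost_extremal.intro almost_extremal_axioms.intro)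
    show "almost_sum_free B B n (192 * e)"
      by (rule almost_sum_free_mono[OF BC(1) Cn sparse(1) e]) (use half n e BC in auto)
  qed (use half in simp)
  have "card (sym_diff B (odd_part n)) \<le> 272640 * e \<or> card (sym_diff B (upper_half n)) \<le> 272640 * e"
    using E.extremal_dichotomy n by simp
  then show ?thesis
  proof
    assume near: "card (sym_diff B (odd_part n)) \<le> 272640 * e"
    have "card (sym_diff A (odd_part n)) \<le> e + 272640 * e"
      by (rule superset_near_odd_part[OF A _ sparse(2) near]) (use BC n e in auto)
    then show ?thesis by simp
  next
    assume near: "card (sym_diff B (upper_half n)) \<le> 272640 * e"
    have "card (sym_diff A (upper_half n)) \<le> 2 * e + 3 * (272640 * e) + 1"
      by (rule superset_near_upper_half[OF A _ sparse(2) near]) (use BC in auto)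
    then show ?thesis using e by simp
  qed
qed

lemma stability:
  fixes r :: nat and \<epsilon> :: real
  assumes r: "r \<ge> 4" and \<epsilon>: "\<epsilon> > 0"
  shows "\<exists>\<delta>::real. \<exists>n\<^sub>0::nat. \<delta> > 0 \<and> n\<^sub>0 > 0 \<and>
        (\<forall>n \<ge> n\<^sub>0. \<forall>A \<subseteq> {1..n}.
          real (g_set A r) \<ge> real r powr (real n / 2 - \<delta> * real n) \<longrightarrow>
          (r \<ge> 5 \<longrightarrow>
             real (card (sym_diff A (odd_part n))) \<le> \<epsilon> * real n \<or>
             real (card (sym_diff A (upper_half n))) \<le> \<epsilon> * real n) \<and>
          (r = 4 \<longrightarrow>
             real (card (sym_diff A {1..n})) \<le> \<epsilon> * real n \<or>
             real (card (sym_diff A (odd_part n))) \<le> \<epsilon> * real n \<or>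
             real (card (sym_diff A (upper_half n))) \<le> \<epsilon> * real n))"
proof -
  define L where "L = log r 2"
  have L: "0 \<le> L" "L \<le> 1 / 2" using log_two_le_half[OF r] r by (auto simp: L_def)
  \<comment> \<open>The first two bounds meet the constants of
    \<open>stability_of_large_exponent\<close>; the third, for \<open>r \<ge> 5\<close>, makes the
    case of small \<open>B\<close> impossible. The same \<open>\<zeta>\<close> serves as
    \<open>\<delta>\<close>.\<close>
  define \<zeta> where "\<zeta> = min (min (\<epsilon> / 10 ^ 6) (1 / 10 ^ 7)) (if r \<ge> 5 then (1 / 2 - L) / 20 else 1)"
  have gap: "1 / 2 - L > 0" if "r \<ge> 5" using log_two_less_half[OF that] by (simp add: L_def)
  have \<zeta>: "\<zeta> > 0" using \<epsilon> gap by (auto simp: \<zeta>_def)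
  have \<zeta>1: "10 ^ 6 * \<zeta> \<le> \<epsilon>" "10 ^ 7 * \<zeta> \<le> 1" and \<zeta>2: "r \<ge> 5 \<Longrightarrow> 20 * \<zeta> \<le> 1 / 2 - L"
    by (auto simp: \<zeta>_def min_def field_simps)
  have r2: "r \<ge> 2" using r by auto
  obtain n0 where n0: "\<And>n A. n \<ge> n0 \<Longrightarrow> A \<subseteq> {1..n} \<Longrightarrow> g_set A r > 0 \<Longrightarrow>
    \<exists>B C e. B \<subseteq> C \<and> C \<subseteq> A \<and> e \<ge> 1 \<and> real e \<le> \<zeta> * real n \<and> \<zeta> * real n \<le> real e + 1
      \<and> card (exceptional B C e) \<le> e \<and> card (exceptional A B e) \<le> e
      \<and> real (g_set A r) \<le> real r powr (\<zeta> * real n + card B + log r 2 * (real (card C) - real (card B)))"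
    by (rule structure_of_many_colorings[OF r2 \<zeta>]) blast
  have main: "(r \<ge> 5 \<longrightarrow>
             real (card (sym_diff A (odd_part n))) \<le> \<epsilon> * real n \<or>
             real (card (sym_diff A (upper_half n))) \<le> \<epsilon> * real n) \<and>
          (r = 4 \<longrightarrow>
             real (card (sym_diff A {1..n})) \<le> \<epsilon> * real n \<or>
             real (card (sym_diff A (odd_part n))) \<le> \<epsilon> * real n \<or>
             real (card (sym_diff A (upper_half n))) \<le> \<epsilon> * real n)"
    if n: "n \<ge> max n0 1" and A: "A \<subseteq> {1..n}" and g: "real (g_set A r) \<ge> real r powr (real n / 2 - \<zeta> * real n)"
    for n A
  proof -
    have "real r powr (real n / 2 - \<zeta> * real n) > 0" using r by simp
    with g have "real (g_set A r) > 0" by linarith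
    then have "g_set A r > 0" by simp
    then obtain B C e where BC: "B \<subseteq> C" "C \<subseteq> A" and e: "e \<ge> 1" "real e \<le> \<zeta> * n" "\<zeta> * n \<le> real e + 1"
      and exc: "card (exceptional B C e) \<le> e" "card (exceptional A B e) \<le> e"
      and g2: "real (g_set A r) \<le> real r powr (\<zeta> * real n + card B + log r 2 * (real (card C) - real (card B)))"
      using n0[of n A] n A by auto
    have "real r powr (real n / 2 - \<zeta> * real n)
        \<le> real r powr (\<zeta> * real n + card B + log r 2 * (real (card C) - real (card B)))"
      using g g2 by linarith
    then have ex: "real n / 2 \<le> 2 * (\<zeta> * n) + card B + L * (real (card C) - real (card B))"
      using r by (simp add: L_def)
    have finA: "finite A" using A by (rule finite_subset) simp
    have finC: "finite C" using BC(2) finA by (rule finite_subset)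
    have cBC: "card B \<le> card C" "card C \<le> card A"
      using card_mono[OF finC BC(1)] card_mono[OF finA BC(2)] by simp_all
    have cA: "card A \<le> n" using card_mono[OF _ A] by simp
    have n0: "real n > 0" using n by simp
    have \<epsilon>n: "10 ^ 6 * (\<zeta> * n) \<le> \<epsilon> * n" "10 ^ 7 * (\<zeta> * n) \<le> n"
      using mult_right_mono[OF \<zeta>1(1), of n] mult_right_mono[OF \<zeta>1(2), of n] by (simp_all add: mult.assoc)
    show ?thesis
    proof (cases "card B > 8 * e")
      case True
      have "L * (real (card C) - real (card B)) \<le> 1 / 2 * (real (card C) - real (card B))"
        using L cBC by (intro mult_right_mono) auto
      then have "2 * (L * (real (card C) - real (card B))) \<le> real (card C) - real (card B)" by simp
      \<comment> \<open>Since \<open>\<zeta> * n \<le> e + 1\<close> and \<open>e \<ge> 1\<close>,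
        the term \<open>4 * (\<zeta> * n)\<close> is at most \<open>8 * e\<close>.\<close>
      then have "real n \<le> 4 * (\<zeta> * n) + card B + card C" using ex by linarith
      then have "real n \<le> real (card B + card C + 8 * e)" using e by simp
      then have large: "n \<le> card B + card C + 8 * e" by linarith
      have "real (10 ^ 7 * e) \<le> real n" using e(2) \<epsilon>n(2) by simp
      then have ne: "n \<ge> 10 ^ 7 * e" by linarith
      have "real (10 ^ 6 * e) \<le> \<epsilon> * n" using e(2) \<epsilon>n(1) by simp
      then have "real x \<le> \<epsilon> * n" if "x \<le> 10 ^ 6 * e" for x using that by linarith
      then show ?thesis
        using stability_of_large_exponent[OF BC A e(1) exc True large ne] by blast
    next
      case False
      then have B8: "real (card B) \<le> 8 * (\<zeta> * n)" using e(2) by linarith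
      show ?thesis
      proof (intro conjI impI)
        assume r5: "r \<ge> 5"
        \<comment> \<open>With \<open>B\<close> negligible, at most about
          \<open>r powr (L * n)\<close> colorings remain, too few as
          \<open>L < 1 / 2\<close>.\<close>
        have "L * (real (card C) - real (card B)) \<le> L * real n"
          using L cBC cA by (intro mult_left_mono) auto
        then have "(1 / 2 - L) * n \<le> 10 * (\<zeta> * n)" using ex B8 by (simp add: algebra_simps)
        moreover have "20 * \<zeta> * n \<le> (1 / 2 - L) * n" using \<zeta>2[OF r5] by (intro mult_right_mono) auto
        moreover have "\<zeta> * n > 0" using \<zeta> n0 by simp
        ultimately have False by linarith
        then show "real (card (sym_diff A (odd_part n))) \<le> \<epsilon> * real n \<or>
             real (card (sym_diff A (upper_half n))) \<le> \<epsilon> * real n" ..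
      next
        assume "r = 4"
        \<comment> \<open>For \<open>r = 4\<close>, two colors on every element already give
          exponent \<open>n / 2\<close>; so a negligible \<open>B\<close> forces \<open>C\<close>,
          and with it \<open>A\<close>, to be almost all of \<open>{1..n}\<close>.\<close>
        then have "L = 1 / 2" using log_four_two by (simp add: L_def)
        then have "2 * (L * (real (card C) - real (card B))) = real (card C) - real (card B)" by simp
        with ex have "real n \<le> 4 * (\<zeta> * n) + card B + card C" by linarith
        then have "real n \<le> 12 * (\<zeta> * n) + card A" using B8 cBC by linarith
        moreover have "card (sym_diff A {1..n}) = n - card A"
        proof -
          have "sym_diff A {1..n} = {1..n} - A" using A by auto
          then show ?thesis using A finA by (simp add: card_Diff_subset)
        qed
        moreover have "0 \<le> \<zeta> * n" using \<zeta> by simp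
        ultimately have "real (card (sym_diff A {1..n})) \<le> \<epsilon> * n"
          using cA \<epsilon>n(1) by (simp add: of_nat_diff)
        then show "real (card (sym_diff A {1..n})) \<le> \<epsilon> * real n \<or>
             real (card (sym_diff A (odd_part n))) \<le> \<epsilon> * real n \<or>
             real (card (sym_diff A (upper_half n))) \<le> \<epsilon> * real n" ..
      qed
    qed
  qed
  show ?thesis
  proof (rule exI[of _ \<zeta>], rule exI[of _ "max n0 1"], intro conjI)
    show "\<zeta> > 0" "max n0 1 > 0" using \<zeta> by auto
  qed (intro allI impI main)
qed

theorem mainTheorem4:
  fixes r :: nat
  assumes "r \<ge> 4"
  shows "(\<exists>h \<in> o(\<lambda>n::nat. real n). \<forall>n. real (g_max n r) = real r powr (real n / 2 + h n)) \<and>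
    (\<forall>\<epsilon>::real. \<epsilon> > 0 \<longrightarrow>
      (\<exists>\<delta>::real. \<exists>n\<^sub>0::nat. \<delta> > 0 \<and> n\<^sub>0 > 0 \<and>
        (\<forall>n \<ge> n\<^sub>0. \<forall>A \<subseteq> {1..n}.
          real (g_set A r) \<ge> real r powr (real n / 2 - \<delta> * real n) \<longrightarrow>
          (r \<ge> 5 \<longrightarrow>
             real (card (sym_diff A (odd_part n))) \<le> \<epsilon> * real n \<or>
             real (card (sym_diff A (upper_half n))) \<le> \<epsilon> * real n) \<and>
          (r = 4 \<longrightarrow>
             real (card (sym_diff A {1..n})) \<le> \<epsilon> * real n \<or>
             real (card (sym_diff A (odd_part n))) \<le> \<epsilon> * real n \<or>
             real (card (sym_diff A (upper_half n))) \<le> \<epsilon> * real n))))"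
  using g_max_exponent[OF assms] stability[OF assms] by (intro conjI allI impI)

end
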